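(* Let $X$ be a manifold of dimension $n$ with tangent bundle $T$ and cotangent bundle $T^*$, and let $\omega$ be a nondegenerate metric on $X$. Let $g_1\subset\hat g_1\subset T^*\otimes T$ be the symbols of the Killing and conformal Killing systems of $\omega$, let $g_2$, $\hat g_2$ and $\hat g_3$ be their successive prolongations, and let $Z^2(\cdot)$, $H^2(\cdot)$ be the $\delta$-cocycle and $\delta$-cohomology bundles at $\wedge^2T^*\otimes g_1$ and at $\wedge^2T^*\otimes\hat g_1$ respectively. Taking into account that $g_1\subset\hat g_1$, $g_2=0$, $\hat g_2\simeq T^*$ and $\hat g_3=0$, there is a commutative diagram with exact rows and exact columns $$\begin{array}{ccccccccc} & & & & & & & 0 & \\ & & & & & & & \downarrow & \\ & & & & & 0 & & S_2T^* & \\ & & & & & \downarrow & & \downarrow & \\ & & & 0 & \longrightarrow & Z^2(g_1) & \longrightarrow & H^2(g_1) & \longrightarrow 0\\ & & & \downarrow & & \downarrow & & \downarrow & \\ & 0 & \longrightarrow & T^*\otimes\hat g_2 & \stackrel{\delta}{\longrightarrow} & Z^2(\hat g_1) & \longrightarrow & H^2(\hat g_1) & \longrightarrow 0\\ & & & \downarrow & & \downarrow & & \downarrow & \\ 0\longrightarrow & S_2T^* & \stackrel{\delta}{\longrightarrow} & T^*\otimes T^* & \stackrel{\delta}{\longrightarrow} & \wedge^2T^* & \longrightarrow & 0 & \\ & & & \downarrow & & \downarrow & & & \\ & & & 0 & & 0 & & & \end{array}$$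
   Context: Symbols. In local coordinates, $g_1\subset T^*\otimes T$ is the bundle of $(\xi^k_i)$ with $\omega_{rj}\xi^r_i+\omega_{ir}\xi^r_j=0$, and $\hat g_1\subset T^*\otimes T$ is the bundle of $(\xi^k_i)$ with $\omega_{rj}\xi^r_i+\omega_{ir}\xi^r_j-\frac2n\omega_{ij}\xi^r_r=0$. For $q\geq 1$ the prolongations are $g_{q+1}=(T^*\otimes g_q)\cap(S_{q+1}T^*\otimes T)$ and $\hat g_{q+1}=(T^*\otimes\hat g_q)\cap(S_{q+1}T^*\otimes T)$. Here $S_q T^*$ denotes the symmetric power and $\wedge^rT^*$ the exterior power of $T^*$. The isomorphism $\hat g_2\simeq T^*$ taken into account in the claim is the one in which the elements of $\hat g_2$ are written $\xi^k_{ij}=\delta^k_ia_j+\delta^k_ja_i-\omega_{ij}\omega^{kr}a_r$ with $(a_i)\in T^*$, so that $\xi^r_{ri}=n a_i$. Spencer map. $\delta:\wedge^rT^*\otimes S_{q+1}T^*\otimes T\to\wedge^{r+1}T^*\otimes S_qT^*\otimes T$ is the purely algebraic map $(\delta\xi)^k_{\mu}=dx^i\wedge\xi^k_{\mu+1_i}$ (where $\mu$ is a multi-index of length $q$, $\mu+1_i$ is $\mu$ with its $i$-th entry increased by one, and $\xi^k_{\mu+1_i}$ is an $r$-form). It satisfies $\delta\circ\delta=0$ and restricts to $\delta:\wedge^rT^*\otimes g_{q+1}\to\wedge^{r+1}T^*\otimes g_q$, and similarly for $\hat g$. Then $$Z^2(g_1)=\ker(\delta:\wedge^2T^*\otimes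 g_1\to\wedge^3T^*\otimes T),\qquad H^2(g_1)=Z^2(g_1)/\delta(T^*\otimes g_2),$$ and likewise $Z^2(\hat g_1)=\ker(\delta:\wedge^2T^*\otimes \hat g_1\to\wedge^3T^*\otimes T)$ and $H^2(\hat g_1)=Z^2(\hat g_1)/\delta(T^*\otimes\hat g_2)$. Maps in the diagram. The maps $Z^2\to H^2$ are the canonical projections; $Z^2(g_1)\to Z^2(\hat g_1)$ and $H^2(g_1)\to H^2(\hat g_1)$ are induced by $g_1\subset\hat g_1$; $T^*\otimes\hat g_2\to T^*\otimes T^*$ is induced by the isomorphism $\hat g_2\simeq T^*$, $(\xi^k_{ij})\mapsto(\xi^r_{ri})$; $Z^2(\hat g_1)\to\wedge^2T^*$ is induced by the trace $\hat g_1\to\hat g_1/g_1\simeq\mathbb R$, $(\xi^k_i)\mapsto\xi^r_r$. The bottom row is the usual $\delta$-sequence, with $S_2T^*\to T^*\otimes T^*$ the canonical inclusion and $T^*\otimes T^*\to\wedge^2T^*$ the skew-symmetrization $dx^j\otimes dx^i\mapsto dx^i\wedge dx^j$. The remaining arrow $S_2T^*\to H^2(g_1)$ in the right column is a monomorphism whose existence (with the column exact) is part of the statement. *)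

theory Defs
  imports "HOL-Analysis.Analysis" "HOL-Library.Set_Algebras"
begin

section \<open>Smooth manifolds, described by an atlas\<close>

fun times_differentiable_on :: "nat \<Rightarrow> 'a::euclidean_space set \<Rightarrow> ('a \<Rightarrow> 'b::real_normed_vector) \<Rightarrow> bool"
  where
    "times_differentiable_on 0 S f \<longleftrightarrow> continuous_on S f"
  | "times_differentiable_on (Suc k) S f \<longleftrightarrow>
       (\<forall>x\<in>S. f differentiable (at x)) \<and>
       (\<forall>v. times_differentiable_on k S (\<lambda>x. frechet_derivative f (at x) v))"

text \<open>Class C-infinity; only used for open \<^term>\<open>S\<close>.\<close>

definition smooth_on :: "'a::euclidean_space set \<Rightarrow> ('a \<Rightarrow> 'b::real_normed_vector) \<Rightarrow> bool"
  where "smooth_on S f \<longleftrightarrow> (\<forall>k. times_differentiable_on k S f)"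

type_synonym ('x, 'n) chart = "'x set \<times> ('x \<Rightarrow> real ^ 'n)"

definition coord_change :: "('x, 'n::finite) chart \<Rightarrow> ('x, 'n) chart \<Rightarrow> real ^ 'n \<Rightarrow> real ^ 'n"
  where "coord_change c c' = snd c' \<circ> inv_into (fst c) (snd c)"

definition smooth_manifold :: "'x topology \<Rightarrow> ('x, 'n::finite) chart set \<Rightarrow> bool"
  where "smooth_manifold X \<A> \<longleftrightarrow>
    Hausdorff_space X \<and> second_countable X \<and>
    (\<Union>c\<in>\<A>. fst c) = topspace X \<and>
    (\<forall>c\<in>\<A>. openin X (fst c) \<and> open (snd c ` fst c) \<and>
       homeomorphic_map (subtopology X (fst c)) (top_of_set (snd c ` fst c)) (snd c)) \<and>
    (\<forall>c\<in>\<A>. \<forall>c'\<in>\<A>. smooth_on (snd c ` (fst c \<inter> fst c')) (coord_change c c'))"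

text \<open>
  Tensor bundles of the manifold are described by components with respect to each chart. The
  Jacobian has entries \<open>jacobian c c' x $ k $ i\<close>, the derivative at x of the k-th coordinate
  of c' in the direction of the i-th coordinate of c.
\<close>

definition jacobian :: "('x, 'n::finite) chart \<Rightarrow> ('x, 'n) chart \<Rightarrow> 'x \<Rightarrow> real ^ 'n ^ 'n"
  where "jacobian c c' x = matrix (frechet_derivative (coord_change c c') (at (snd c x)))"

text \<open>
  Change of components, from the chart c' to the chart c with P the Jacobian, of an element of
  \<open>T\<^sup>*\<otimes>T\<^sup>*\<close> and of an element of \<open>\<And>\<^sup>2T\<^sup>*\<otimes>T\<^sup>*\<otimes>T\<close> (the upper index comes last).
\<close>

definition change_cov2 :: "real ^ 'n ^ 'n \<Rightarrow> real ^ 'n ^ 'n \<Rightarrow> real ^ 'n ^ 'n::finite"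
  where "change_cov2 P a = transpose P ** a ** P"

definition change_form2 ::
  "real ^ 'n ^ 'n \<Rightarrow> real ^ 'n ^ 'n ^ 'n ^ 'n \<Rightarrow> real ^ 'n ^ 'n ^ 'n ^ 'n::finite"
  where "change_form2 P z = (\<chi> i j s k. \<Sum>i'\<in>UNIV. \<Sum>j'\<in>UNIV. \<Sum>s'\<in>UNIV. \<Sum>k'\<in>UNIV.
    P $ i' $ i * P $ j' $ j * P $ s' $ s * matrix_inv P $ k $ k' * z $ i' $ j' $ s' $ k')"

definition nondegenerate_metric ::
  "('x, 'n::finite) chart set \<Rightarrow> (('x, 'n) chart \<Rightarrow> 'x \<Rightarrow> real ^ 'n ^ 'n) \<Rightarrow> bool"
  where "nondegenerate_metric \<A> \<omega> \<longleftrightarrow>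
    (\<forall>c\<in>\<A>. \<forall>x\<in>fst c. transpose (\<omega> c x) = \<omega> c x \<and> invertible (\<omega> c x)) \<and>
    (\<forall>c\<in>\<A>. smooth_on (snd c ` fst c) (\<lambda>y. \<omega> c (inv_into (fst c) (snd c) y))) \<and>
    (\<forall>c\<in>\<A>. \<forall>c'\<in>\<A>. \<forall>x\<in>fst c \<inter> fst c'. \<omega> c x = change_cov2 (jacobian c c' x) (\<omega> c' x))"


section \<open>Vector spaces with explicit carrier, quotients and exactness\<close>

text \<open>A record is needed since quotient spaces consist of cosets, on which the operations and the
  zero are not those of a type class.\<close>

record 'v vspace =
  carr :: "'v set"
  vadd :: "'v \<Rightarrow> 'v \<Rightarrow> 'v"
  vscale :: "real \<Rightarrow> 'v \<Rightarrow> 'v"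
  vzero :: 'v

definition sub_space :: "'v::real_vector set \<Rightarrow> 'v vspace"
  where "sub_space V = \<lparr>carr = V, vadd = (+), vscale = (*\<^sub>R), vzero = 0\<rparr>"

text \<open>The coset of z is \<open>z +o B\<close>; adding \<^term>\<open>B\<close> in the scalar multiplication matters for
  the scalar 0 only.\<close>

definition quot_space :: "'v::real_vector set \<Rightarrow> 'v set \<Rightarrow> 'v set vspace"
  where "quot_space Z B =
    \<lparr>carr = (\<lambda>z. z +o B) ` Z, vadd = (+), vscale = (\<lambda>r C. (*\<^sub>R) r ` C + B), vzero = B\<rparr>"

definition lin_map :: "'v vspace \<Rightarrow> 'w vspace \<Rightarrow> ('v \<Rightarrow> 'w) \<Rightarrow> bool"
  where "lin_map E F f \<longleftrightarrow>
    (\<forall>u\<in>carr E. f u \<in> carr F) \<and>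
    (\<forall>u\<in>carr E. \<forall>v\<in>carr E. f (vadd E u v) = vadd F (f u) (f v)) \<and>
    (\<forall>r. \<forall>u\<in>carr E. f (vscale E r u) = vscale F r (f u))"

definition lin_iso :: "'v vspace \<Rightarrow> 'w vspace \<Rightarrow> ('v \<Rightarrow> 'w) \<Rightarrow> bool"
  where "lin_iso E F f \<longleftrightarrow> lin_map E F f \<and> bij_betw f (carr E) (carr F)"

text \<open>Exactness of \<open>0 \<rightarrow> E \<rightarrow> F \<rightarrow> G \<rightarrow> 0\<close> with maps f and g.\<close>

definition short_exact ::
  "'u vspace \<Rightarrow> ('u \<Rightarrow> 'v) \<Rightarrow> 'v vspace \<Rightarrow> ('v \<Rightarrow> 'w) \<Rightarrow> 'w vspace \<Rightarrow> bool"
  where "short_exact E f F g G \<longleftrightarrow>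
    lin_map E F f \<and> lin_map F G g \<and>
    inj_on f (carr E) \<and>
    f ` carr E = {v \<in> carr F. g v = vzero G} \<and>
    g ` carr F = carr G"


section \<open>Symbols, prolongations and Spencer cohomology\<close>

text \<open>
  The first tensor factor is the outermost index, form indices precede all others and the index in
  T comes last. Thus \<open>\<xi> $ i $ k\<close> is the component of \<open>\<xi>\<close> in \<open>T\<^sup>*\<otimes>T\<close> with lower index i and upper
  index k. The type \<^typ>\<open>'b\<close> below stands for the remaining factors.
\<close>

definition cotensor :: "'b set \<Rightarrow> ('b ^ 'n::finite) set"
  where "cotensor E = {\<xi>. \<forall>i. \<xi> $ i \<in> E}"

definition sym2 :: "('b ^ 'n ^ 'n::finite) set"
  where "sym2 = {\<xi>. \<forall>i j. \<xi> $ i $ j = \<xi> $ j $ i}"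

definition sym3 :: "('b ^ 'n ^ 'n ^ 'n::finite) set"
  where "sym3 = {\<xi>. \<forall>i j l. \<xi> $ i $ j $ l = \<xi> $ j $ i $ l \<and> \<xi> $ i $ j $ l = \<xi> $ i $ l $ j}"

definition wedge2 :: "'b::real_vector set \<Rightarrow> ('b ^ 'n ^ 'n::finite) set"
  where "wedge2 E = {z. \<forall>i j. z $ i $ j \<in> E \<and> z $ i $ j = - (z $ j $ i)}"

definition killing_symbol :: "real ^ 'n ^ 'n \<Rightarrow> (real ^ 'n ^ 'n::finite) set"
  where "killing_symbol w = {\<xi>. \<forall>i j.
    (\<Sum>r\<in>UNIV. w $ r $ j * \<xi> $ i $ r) + (\<Sum>r\<in>UNIV. w $ i $ r * \<xi> $ j $ r) = 0}"

definition conf_killing_symbol :: "real ^ 'n ^ 'n \<Rightarrow> (real ^ 'n ^ 'n::finite) set"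
  where "conf_killing_symbol w = {\<xi>. \<forall>i j.
    (\<Sum>r\<in>UNIV. w $ r $ j * \<xi> $ i $ r) + (\<Sum>r\<in>UNIV. w $ i $ r * \<xi> $ j $ r)
      - 2 / real CARD('n) * w $ i $ j * (\<Sum>r\<in>UNIV. \<xi> $ r $ r) = 0}"

text \<open>For \<open>E\<close> inside \<open>T\<^sup>*\<otimes>T\<close>, its first and second prolongation. The second prolongation
  of the conformal Killing symbol vanishes only in dimension at least 3, whence the restriction on
  the dimension in the theorem.\<close>

definition prolong2 :: "('b ^ 'n) set \<Rightarrow> ('b ^ 'n ^ 'n::finite) set"
  where "prolong2 E = cotensor E \<inter> sym2"

definition prolong3 :: "('b ^ 'n) set \<Rightarrow> ('b ^ 'n ^ 'n ^ 'n::finite) set"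
  where "prolong3 E = cotensor (prolong2 E) \<inter> sym3"

text \<open>
  The Spencer maps on 1-forms and on 2-forms. A form with alternating components
  \<open>\<alpha>\<^bsub>i\<^esub>\<close> or \<open>\<alpha>\<^bsub>ij\<^esub>\<close> is the sum of \<open>\<alpha>\<^bsub>i\<^esub>dx\<^sup>i\<close> over i, respectively of \<open>\<alpha>\<^bsub>ij\<^esub>dx\<^sup>i\<and>dx\<^sup>j\<close> over
  i < j, and the lines below are the components of \<open>dx\<^sup>i \<and> \<xi>\<^bsub>\<mu>+1\<^sub>i\<^esub>\<close>. On
  \<open>T\<^sup>*\<otimes>T\<^sup>*\<close>, with \<^typ>\<open>'b\<close> the reals, the first one maps \<open>dx\<^sup>j\<otimes>dx\<^sup>i\<close> to \<open>dx\<^sup>i\<and>dx\<^sup>j\<close>.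
  On 0-forms the Spencer map is the inclusion of \<^const>\<open>sym2\<close>.
\<close>

definition spencer1 :: "'b::real_vector ^ 'n ^ 'n \<Rightarrow> 'b ^ 'n ^ 'n::finite"
  where "spencer1 \<xi> = (\<chi> i j. \<xi> $ j $ i - \<xi> $ i $ j)"

definition spencer2 :: "'b::real_vector ^ 'n ^ 'n ^ 'n \<Rightarrow> 'b ^ 'n ^ 'n ^ 'n::finite"
  where "spencer2 z = (\<chi> i j l. z $ j $ l $ i + z $ l $ i $ j + z $ i $ j $ l)"

definition cocycles2 :: "('b::real_vector ^ 'n) set \<Rightarrow> ('b ^ 'n ^ 'n ^ 'n::finite) set"
  where "cocycles2 E = {z \<in> wedge2 E. spencer2 z = 0}"

definition coboundaries2 :: "('b::real_vector ^ 'n) set \<Rightarrow> ('b ^ 'n ^ 'n ^ 'n::finite) set"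
  where "coboundaries2 E = spencer1 ` cotensor (prolong2 E)"

definition cohomology2 :: "('b::real_vector ^ 'n) set \<Rightarrow> ('b ^ 'n ^ 'n ^ 'n::finite) set vspace"
  where "cohomology2 E = quot_space (cocycles2 E) (coboundaries2 E)"

definition cohomology_class ::
  "('b::real_vector ^ 'n) set \<Rightarrow> 'b ^ 'n ^ 'n ^ 'n \<Rightarrow> ('b ^ 'n ^ 'n ^ 'n::finite) set"
  where "cohomology_class E z = z +o coboundaries2 E"

text \<open>The map in cohomology induced by the inclusion of a smaller symbol in \<open>F\<close>.\<close>

definition cohomology_incl ::
  "('b::real_vector ^ 'n) set \<Rightarrow> ('b ^ 'n ^ 'n ^ 'n) set \<Rightarrow> ('b ^ 'n ^ 'n ^ 'n::finite) set"
  where "cohomology_incl F C = C + coboundaries2 F"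

definition trace2 :: "real ^ 'n ^ 'n ^ 'n \<Rightarrow> real ^ 'n::finite"
  where "trace2 \<xi> = (\<chi> i. \<Sum>r\<in>UNIV. \<xi> $ r $ i $ r)"

definition cotensor_trace2 :: "real ^ 'n ^ 'n ^ 'n ^ 'n \<Rightarrow> real ^ 'n ^ 'n::finite"
  where "cotensor_trace2 \<zeta> = (\<chi> j. trace2 (\<zeta> $ j))"

definition form_trace :: "real ^ 'n ^ 'n ^ 'n ^ 'n \<Rightarrow> real ^ 'n ^ 'n::finite"
  where "form_trace z = (\<chi> i j. \<Sum>r\<in>UNIV. z $ i $ j $ r $ r)"

definition conf_element :: "real ^ 'n ^ 'n \<Rightarrow> real ^ 'n \<Rightarrow> real ^ 'n ^ 'n ^ 'n::finite"
  where "conf_element w a = (\<chi> i j k.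
    (if k = i then a $ j else 0) + (if k = j then a $ i else 0)
      - w $ i $ j * (\<Sum>r\<in>UNIV. matrix_inv w $ k $ r * a $ r))"


section \<open>Vector bundle morphisms into the second cohomology bundle of the Killing symbol\<close>

text \<open>
  A smooth morphism from \<open>S\<^sub>2T\<^sup>*\<close>, given by its value in each chart at each point: it is linear
  on fibres, compatible with changes of charts, and smooth. Smoothness into a quotient bundle means
  that smooth (here: constant coefficient) local sections are sent to classes of smooth sections.
\<close>

definition bundle_morphism ::
  "('x, 'n::finite) chart set \<Rightarrow> (('x, 'n) chart \<Rightarrow> 'x \<Rightarrow> real ^ 'n ^ 'n) \<Rightarrow>
    (('x, 'n) chart \<Rightarrow> 'x \<Rightarrow> real ^ 'n ^ 'n \<Rightarrow> (real ^ 'n ^ 'n ^ 'n ^ 'n) set) \<Rightarrow> bool"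
  where "bundle_morphism \<A> \<omega> \<sigma> \<longleftrightarrow>
    (\<forall>c\<in>\<A>. \<forall>x\<in>fst c.
       lin_map (sub_space sym2) (cohomology2 (killing_symbol (\<omega> c x))) (\<sigma> c x)) \<and>
    (\<forall>c\<in>\<A>. \<forall>c'\<in>\<A>. \<forall>x\<in>fst c \<inter> fst c'. \<forall>a\<in>sym2.
       \<sigma> c x (change_cov2 (jacobian c c' x) a) = change_form2 (jacobian c c' x) ` \<sigma> c' x a) \<and>
    (\<forall>c\<in>\<A>. \<forall>a\<in>sym2. \<exists>s. smooth_on (snd c ` fst c) s \<and>
       (\<forall>x\<in>fst c. s (snd c x) \<in> cocycles2 (killing_symbol (\<omega> c x)) \<and>
          \<sigma> c x a = cohomology_class (killing_symbol (\<omega> c x)) (s (snd c x))))"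

end

theory Submission
  imports Defs
begin

text \<open>
  Write \<open>g\<^sub>q\<close> for the Killing symbol and its prolongations, \<open>\<gamma>\<^sub>q\<close> for the conformal
  ones. The columns come from one splitting: an endomorphism is in \<open>\<gamma>\<^sub>1\<close> if and only if its
  trace-free part is in \<open>g\<^sub>1\<close>, so
  \<open>g\<^sub>1\<close> is the kernel of the trace on \<open>\<gamma>\<^sub>1\<close>. A tensor which is symmetric in two
  indices and skew in an overlapping pair vanishes, hence \<open>g\<^sub>2 = 0\<close>. Therefore an element of
  \<open>\<gamma>\<^sub>2\<close> is determined by its trace, and the conformal elements realise every trace; this is
  \<open>\<gamma>\<^sub>2 \<simeq> T\<^sup>*\<close>. The inverse of that isomorphism, tensored with \<open>T\<^sup>*\<close>, is
  \<open>conformal_lift\<close>, a right inverse of the trace on the middle term of the diagram.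

  For \<open>\<gamma>\<^sub>3 = 0\<close>, an element is the lift of a tensor b, which is symmetric because the trace
  commutes with \<open>\<delta>\<close>. Contracting once more, \<open>(n - 2) b\<close> is a multiple of the metric;
  contracting with the inverse metric then shows that b vanishes when n is at least 3.
  As \<open>\<gamma>\<^sub>3\<close> is the kernel of \<open>\<delta>\<close> on \<open>T\<^sup>*\<otimes>\<gamma>\<^sub>2\<close>, this gives exactness of
  the middle row.

  The map \<open>S\<^sub>2T\<^sup>* \<rightarrow> H\<^sup>2(g\<^sub>1)\<close> is the connecting map of the snake lemma: lift b to
  \<open>T\<^sup>*\<otimes>\<gamma>\<^sub>2\<close> and apply \<open>\<delta>\<close> (\<open>schouten_cocycle\<close>). The trace of the
  result is the skew-symmetrization of b, so for symmetric b the result is a cocycle with values in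
  \<open>g\<^sub>1\<close>. It is a coboundary for \<open>\<gamma>\<^sub>1\<close> by construction, and every
  \<open>g\<^sub>1\<close>-cocycle which is a coboundary for \<open>\<gamma>\<^sub>1\<close> arises in this way; that is exactness of
  the right column at \<open>H\<^sup>2(g\<^sub>1)\<close>.
  Surjectivity onto \<open>H\<^sup>2(\<gamma>\<^sub>1)\<close> holds because a suitable Schouten cocycle cancels the
  trace of any given \<open>\<gamma>\<^sub>1\<close>-cocycle.

  The connecting map is a bundle morphism: for symmetric b it is a sum of skew products of b, the
  metric, its inverse and the identity (\<open>schouten_cocycle_eq_skew_product\<close>), which is visibly
  natural, and its components are polynomial in those of the metric and of its inverse. The
  latter are smooth by Cramer's rule.
\<close>

section \<open>Smooth functions on an open set\<close>

lemma times_differentiable_on_cong: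
  assumes "times_differentiable_on k S f" "open S" "\<And>x. x \<in> S \<Longrightarrow> f x = g x"
  shows "times_differentiable_on k S g"
  using assms
proof (induction k arbitrary: f g)
  case 0
  then show ?case using continuous_on_cong[of S S f g] by simp
next
  case (Suc k)
  have D: "(g has_derivative frechet_derivative f (at x)) (at x)" if "x \<in> S" for x
  proof -
    have "(f has_derivative frechet_derivative f (at x)) (at x)"
      using Suc.prems(1) that by (simp add: frechet_derivative_works)
    then show ?thesis
      using has_derivative_transform_within_open Suc.prems that by blast
  qed
  have "times_differentiable_on k S (\<lambda>x. frechet_derivative g (at x) v)" for v
  proof (rule Suc.IH)
    show "times_differentiable_on k S (\<lambda>x. frechet_derivative f (at x) v)"
      using Suc.prems(1) by simp
  next
    show "frechet_derivative f (at x) v = frechet_derivative g (at x) v" if "x \<in> S" for x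
      using frechet_derivative_at[OF D[OF that]] by simp
  qed (rule Suc.prems)
  then show ?case using D by (auto simp: differentiable_def)
qed

text \<open>
  The recursion runs through the chosen derivative \<^const>\<open>frechet_derivative\<close>; on an open set any
  formula for the derivative that is valid there can take its place. With this rule each closure
  property below follows by induction on the order, from the corresponding rule for derivatives.
\<close>

lemma times_differentiable_on_SucI:
  assumes "open S" "\<And>x. x \<in> S \<Longrightarrow> (f has_derivative D x) (at x)"
    and "\<And>v. times_differentiable_on k S (\<lambda>x. D x v)"
  shows "times_differentiable_on (Suc k) S f"
proof -
  have "times_differentiable_on k S (\<lambda>x. frechet_derivative f (at x) v)" for v
    by (rule times_differentiable_on_cong[OF assms(3) assms(1)])
      (simp add: frechet_derivative_at[OF assms(2), symmetric])
  then show ?thesis using assms(2) by (auto simp: differentiable_def)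
qed

lemma times_differentiable_on_SucE:
  assumes "times_differentiable_on (Suc k) S f"
  obtains D where "\<And>x. x \<in> S \<Longrightarrow> (f has_derivative D x) (at x)"
    and "\<And>v. times_differentiable_on k S (\<lambda>x. D x v)"
proof
  show "(f has_derivative frechet_derivative f (at x)) (at x)" if "x \<in> S" for x
    using assms that by (simp add: frechet_derivative_works)
  show "times_differentiable_on k S (\<lambda>x. frechet_derivative f (at x) v)" for v
    using assms by simp
qed

lemma times_differentiable_on_SucD:
  "times_differentiable_on (Suc k) S f \<Longrightarrow> times_differentiable_on k S f"
proof (induction k arbitrary: f)
  case 0
  then show ?case
    by (auto intro!: continuous_at_imp_continuous_on differentiable_imp_continuous_within)
next
  case (Suc k)
  have "times_differentiable_on k S (\<lambda>x. frechet_derivative f (at x) v)" for v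
    using iffD1[OF times_differentiable_on.simps(2) Suc.prems] Suc.IH by blast
  with iffD1[OF times_differentiable_on.simps(2) Suc.prems] show ?case
    unfolding times_differentiable_on.simps(2)[of k] by blast
qed

lemma times_differentiable_on_const: "times_differentiable_on k S (\<lambda>x. c)"
  by (induction k arbitrary: c) auto

lemma times_differentiable_on_linear:
  assumes "times_differentiable_on k S f" "open S" "bounded_linear L"
  shows "times_differentiable_on k S (\<lambda>x. L (f x))"
  using assms(1)
proof (induction k arbitrary: f)
  case 0
  then show ?case by (simp add: bounded_linear.continuous_on[OF assms(3)])
next
  case (Suc k)
  from Suc.prems obtain D where D: "\<And>x. x \<in> S \<Longrightarrow> (f has_derivative D x) (at x)"
    "\<And>v. times_differentiable_on k S (\<lambda>x. D x v)" by (rule times_differentiable_on_SucE) blast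
  show ?case
    using bounded_linear.has_derivative[OF assms(3) D(1)] Suc.IH[OF D(2)]
    by (rule times_differentiable_on_SucI[OF assms(2)])
qed

lemma times_differentiable_on_add:
  assumes "times_differentiable_on k S f" "times_differentiable_on k S g" "open S"
  shows "times_differentiable_on k S (\<lambda>x. f x + g x)"
  using assms(1,2)
proof (induction k arbitrary: f g)
  case 0
  then show ?case by (simp add: continuous_on_add)
next
  case (Suc k)
  from Suc.prems(1) obtain D where D: "\<And>x. x \<in> S \<Longrightarrow> (f has_derivative D x) (at x)"
    "\<And>v. times_differentiable_on k S (\<lambda>x. D x v)" by (rule times_differentiable_on_SucE) blast
  from Suc.prems(2) obtain E where E: "\<And>x. x \<in> S \<Longrightarrow> (g has_derivative E x) (at x)"
    "\<And>v. times_differentiable_on k S (\<lambda>x. E x v)" by (rule times_differentiable_on_SucE) blast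
  show ?case
    using has_derivative_add[OF D(1) E(1)] Suc.IH[OF D(2) E(2)]
    by (rule times_differentiable_on_SucI[OF assms(3)])
qed

lemma times_differentiable_on_mult:
  fixes f g :: "'a::euclidean_space \<Rightarrow> real"
  assumes "times_differentiable_on k S f" "times_differentiable_on k S g" "open S"
  shows "times_differentiable_on k S (\<lambda>x. f x * g x)"
  using assms(1,2)
proof (induction k arbitrary: f g)
  case 0
  then show ?case by (simp add: continuous_on_mult)
next
  case (Suc k)
  from Suc.prems(1) obtain D where D: "\<And>x. x \<in> S \<Longrightarrow> (f has_derivative D x) (at x)"
    "\<And>v. times_differentiable_on k S (\<lambda>x. D x v)" by (rule times_differentiable_on_SucE) blast
  from Suc.prems(2) obtain E where E: "\<And>x. x \<in> S \<Longrightarrow> (g has_derivative E x) (at x)"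
    "\<And>v. times_differentiable_on k S (\<lambda>x. E x v)" by (rule times_differentiable_on_SucE) blast
  have f: "times_differentiable_on k S f" and g: "times_differentiable_on k S g"
    by (rule times_differentiable_on_SucD, rule Suc.prems)+
  show ?case
    using has_derivative_mult[OF D(1) E(1)]
      times_differentiable_on_add[OF Suc.IH[OF f E(2)] Suc.IH[OF D(2) g] assms(3)]
    by (rule times_differentiable_on_SucI[OF assms(3)])
qed

lemma times_differentiable_on_inverse:
  fixes f :: "'a::euclidean_space \<Rightarrow> real"
  assumes "times_differentiable_on k S f" "open S" "\<And>x. x \<in> S \<Longrightarrow> f x \<noteq> 0"
  shows "times_differentiable_on k S (\<lambda>x. inverse (f x))"
  using assms(1)
proof (induction k)
  case 0
  then show ?case using assms(3) by (simp add: continuous_on_inverse)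
next
  case (Suc k)
  from Suc.prems(1) obtain D where D: "\<And>x. x \<in> S \<Longrightarrow> (f has_derivative D x) (at x)"
    "\<And>v. times_differentiable_on k S (\<lambda>x. D x v)" by (rule times_differentiable_on_SucE) blast
  have i: "times_differentiable_on k S (\<lambda>x. inverse (f x))"
    by (rule Suc.IH[OF times_differentiable_on_SucD[OF Suc.prems]])
  have "times_differentiable_on k S (\<lambda>x. - (inverse (f x) * D x v * inverse (f x)))" for v
    by (rule times_differentiable_on_linear[where L = uminus])
      (intro times_differentiable_on_mult i D(2) assms(2) bounded_linear_minus
        bounded_linear_ident)+
  with Deriv.has_derivative_inverse[OF assms(3) D(1)] show ?case
    by (rule times_differentiable_on_SucI[OF assms(2)])
qed

lemma smooth_on_const: "smooth_on S (\<lambda>x. c)"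
  by (simp add: smooth_on_def times_differentiable_on_const)

lemma smooth_on_cong:
  assumes "smooth_on S f" "open S" "\<And>x. x \<in> S \<Longrightarrow> f x = g x"
  shows "smooth_on S g"
  using times_differentiable_on_cong[OF _ assms(2,3)] assms(1) by (simp add: smooth_on_def)

lemma smooth_on_linear:
  "smooth_on S f \<Longrightarrow> open S \<Longrightarrow> bounded_linear L \<Longrightarrow> smooth_on S (\<lambda>x. L (f x))"
  by (simp add: smooth_on_def times_differentiable_on_linear)

lemma smooth_on_add:
  "smooth_on S f \<Longrightarrow> smooth_on S g \<Longrightarrow> open S \<Longrightarrow> smooth_on S (\<lambda>x. f x + g x)"
  by (simp add: smooth_on_def times_differentiable_on_add)

lemma smooth_on_diff:
  assumes "smooth_on S f" "smooth_on S g" "open S"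
  shows "smooth_on S (\<lambda>x. f x - g x)"
  using smooth_on_add[OF assms(1)
      smooth_on_linear[OF assms(2,3) bounded_linear_minus[OF bounded_linear_ident]] assms(3)]
  by simp

lemma smooth_on_mult:
  fixes f g :: "'a::euclidean_space \<Rightarrow> real"
  shows "smooth_on S f \<Longrightarrow> smooth_on S g \<Longrightarrow> open S \<Longrightarrow> smooth_on S (\<lambda>x. f x * g x)"
  by (simp add: smooth_on_def times_differentiable_on_mult)

lemma smooth_on_inverse:
  fixes f :: "'a::euclidean_space \<Rightarrow> real"
  shows "smooth_on S f \<Longrightarrow> open S \<Longrightarrow> (\<And>x. x \<in> S \<Longrightarrow> f x \<noteq> 0) \<Longrightarrow> smooth_on S (\<lambda>x. inverse (f x))"
  by (simp add: smooth_on_def times_differentiable_on_inverse)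

lemma smooth_on_sum:
  assumes "\<And>i. i \<in> I \<Longrightarrow> smooth_on S (f i)" "open S"
  shows "smooth_on S (\<lambda>x. \<Sum>i\<in>I. f i x)"
  using assms(1)
  by (induction I rule: infinite_finite_induct)
    (simp_all add: smooth_on_const smooth_on_add assms(2))

lemma smooth_on_prod:
  fixes f :: "'i \<Rightarrow> 'a::euclidean_space \<Rightarrow> real"
  assumes "\<And>i. i \<in> I \<Longrightarrow> smooth_on S (f i)" "open S"
  shows "smooth_on S (\<lambda>x. \<Prod>i\<in>I. f i x)"
  using assms(1)
  by (induction I rule: infinite_finite_induct)
    (simp_all add: smooth_on_const smooth_on_mult assms(2))

lemma smooth_on_vec_nth:
  fixes f :: "'a::euclidean_space \<Rightarrow> 'b::real_normed_vector ^ 'n::finite"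
  shows "smooth_on S f \<Longrightarrow> open S \<Longrightarrow> smooth_on S (\<lambda>x. f x $ i)"
  by (rule smooth_on_linear[OF _ _ bounded_linear_vec_nth])

lemma bounded_linear_axis: "bounded_linear (axis i :: 'b::real_normed_vector \<Rightarrow> 'b ^ 'n::finite)"
proof (rule bounded_linear_intro[where K = 1])
  fix x y :: 'b and r :: real
  show "axis i (x + y) = axis i x + axis i y" "axis i (r *\<^sub>R x) = r *\<^sub>R axis i x"
    by (simp_all add: axis_def vec_eq_iff)
  have "L2_set (\<lambda>j. norm (axis i x $ j)) UNIV \<le> (\<Sum>j\<in>UNIV. norm (axis i x $ j))"
    by (rule L2_set_le_sum) simp
  also have "\<dots> = (\<Sum>j\<in>UNIV. if j = i then norm x else 0)"
    by (rule sum.cong) (simp_all add: axis_def)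
  finally show "norm (axis i x) \<le> norm x * 1" by (simp add: norm_vec_def)
qed

lemma smooth_on_vec_lambda:
  fixes f :: "'n::finite \<Rightarrow> 'a::euclidean_space \<Rightarrow> 'b::real_normed_vector"
  assumes "\<And>i. smooth_on S (f i)" "open S"
  shows "smooth_on S (\<lambda>x. \<chi> i. f i x)"
proof -
  have "(\<chi> i. f i x) = (\<Sum>i\<in>UNIV. axis i (f i x))" for x
    by (simp add: vec_eq_iff axis_def)
  then show ?thesis
    using smooth_on_sum[OF smooth_on_linear[OF assms bounded_linear_axis] assms(2)] by simp
qed

lemma smooth_on_det:
  fixes A :: "'a::euclidean_space \<Rightarrow> real ^ 'n ^ 'n::finite"
  assumes "\<And>i j. smooth_on S (\<lambda>x. A x $ i $ j)" "open S"
  shows "smooth_on S (\<lambda>x. det (A x))"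
  unfolding det_def
  by (intro smooth_on_sum smooth_on_mult smooth_on_prod smooth_on_const assms)

lemma matrix_inv_works:
  fixes A :: "real ^ 'n ^ 'n::finite"
  assumes "invertible A"
  shows "A ** matrix_inv A = mat 1" "matrix_inv A ** A = mat 1"
  using someI_ex[OF assms[unfolded invertible_def]] unfolding matrix_inv_def by auto

text \<open>
  By Cramer's rule an entry of the inverse is a quotient of two determinants.
\<close>

lemma smooth_on_matrix_inv:
  fixes A :: "'a::euclidean_space \<Rightarrow> real ^ 'n ^ 'n::finite"
  assumes "\<And>i j. smooth_on S (\<lambda>x. A x $ i $ j)" "open S" "\<And>x. x \<in> S \<Longrightarrow> invertible (A x)"
  shows "smooth_on S (\<lambda>x. matrix_inv (A x) $ k $ r)"
proof -
  let ?B = "\<lambda>x. \<chi> i j. if j = k then axis r 1 $ i else A x $ i $ j"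
  have eq: "det (?B x) * inverse (det (A x)) = matrix_inv (A x) $ k $ r" if "x \<in> S" for x
  proof -
    have "A x *v (matrix_inv (A x) *v axis r 1) = axis r 1"
      by (simp add: matrix_vector_mul_assoc matrix_inv_works assms(3) that)
    moreover have "det (A x) \<noteq> 0" using assms(3)[OF that] by (simp add: invertible_det_nz)
    ultimately have "matrix_inv (A x) *v axis r 1
        = (\<chi> k. det (\<chi> i j. if j = k then axis r 1 $ i else A x $ i $ j) / det (A x))"
      by (simp add: cramer)
    then have "(matrix_inv (A x) *v axis r 1) $ k = det (?B x) / det (A x)" by simp
    moreover have "(matrix_inv (A x) *v axis r 1) $ k = matrix_inv (A x) $ k $ r"
      by (simp add: matrix_vector_mult_basis column_def)
    ultimately show ?thesis by (simp add: divide_inverse)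
  qed
  have smooth: "smooth_on S (\<lambda>x. det (?B x) * inverse (det (A x)))"
  proof (intro smooth_on_mult smooth_on_inverse smooth_on_det assms)
    show "smooth_on S (\<lambda>x. ?B x $ i $ j)" for i j
      by (cases "j = k") (simp_all add: smooth_on_const assms)
    show "det (A x) \<noteq> 0" if "x \<in> S" for x using assms(3)[OF that] by (simp add: invertible_det_nz)
  qed
  show ?thesis by (rule smooth_on_cong[OF smooth assms(2) eq])
qed

section \<open>Cosets and the Spencer sequence of a symbol\<close>

lemma coset_eq_iff:
  assumes "subspace B"
  shows "z +o B = z' +o B \<longleftrightarrow> z - z' \<in> B"
proof
  assume "z +o B = z' +o B"
  moreover have "z \<in> z +o B" using set_plus_intro2[OF subspace_0[OF assms], of z] by simp
  ultimately show "z - z' \<in> B" using set_plus_imp_minus by blast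
next
  assume *: "z - z' \<in> B"
  then have "z' - z \<in> B" using subspace_neg[OF assms, of "z - z'"] by simp
  have "u +o B \<subseteq> u' +o B" if "u - u' \<in> B" for u u'
  proof
    fix x assume "x \<in> u +o B"
    then have "x - u \<in> B" by (rule set_plus_imp_minus)
    with that have "x - u' \<in> B" using subspace_add[OF assms, of "x - u" "u - u'"] by simp
    then show "x \<in> u' +o B" by (rule set_minus_imp_plus)
  qed
  with * \<open>z' - z \<in> B\<close> show "z +o B = z' +o B" by blast
qed

text \<open>
  The operations of a quotient space are sums of subsets; these identities bring such a sum back to
  a single coset.
\<close>

lemma subspace_plus_absorb:
  assumes "subspace B" "subspace C" "B \<subseteq> C"
  shows "B + C = C" "(*\<^sub>R) r ` B + C = C"
proof -
  have "D + C = C" if "0 \<in> D" "D \<subseteq> C" for D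
  proof
    show "D + C \<subseteq> C" using that subspace_add[OF assms(2)] by (auto elim!: set_plus_elim)
    show "C \<subseteq> D + C" using set_zero_plus2[OF that(1)] .
  qed
  moreover have "0 \<in> B" by (rule subspace_0[OF assms(1)])
  moreover have "0 \<in> (*\<^sub>R) r ` B" using \<open>0 \<in> B\<close> by force
  moreover have "(*\<^sub>R) r ` B \<subseteq> C" using assms subspace_scale by blast
  ultimately show "B + C = C" "(*\<^sub>R) r ` B + C = C" using assms(3) by blast+
qed

lemma scale_coset: "(*\<^sub>R) r ` (u +o B) = r *\<^sub>R u +o (*\<^sub>R) r ` B"
  for u :: "'v::real_vector"
  by (force simp: elt_set_plus_def scaleR_add_right)

lemma lin_map_sub_spaceI:
  assumes "linear f" "\<And>u. u \<in> Z \<Longrightarrow> f u \<in> W"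
  shows "lin_map (sub_space Z) (sub_space W) f"
  using assms by (simp add: lin_map_def sub_space_def linear_add linear_scale)

lemma lin_map_comp:
  "lin_map E F f \<Longrightarrow> lin_map F G g \<Longrightarrow> lin_map E G (\<lambda>u. g (f u))"
  by (simp add: lin_map_def)

lemma lin_map_coset:
  assumes "subspace B"
  shows "lin_map (sub_space Z) (quot_space Z B) (\<lambda>z. z +o B)"
  unfolding lin_map_def sub_space_def quot_space_def
  by (simp add: set_plus_rearranges scale_coset subspace_plus_absorb[OF assms assms])
    (simp add: add.commute)

lemma lin_map_enlarge_cosets:
  assumes "subspace B" "subspace C" "B \<subseteq> C" "Z \<subseteq> W"
  shows "lin_map (quot_space Z B) (quot_space W C) (\<lambda>D. D + C)"
  using assms(4) unfolding lin_map_def quot_space_def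
  by (auto simp: set_plus_rearranges scale_coset
      subspace_plus_absorb[OF assms(1,1)] subspace_plus_absorb[OF assms(1,2,3)]
      subspace_plus_absorb[OF assms(2,2)])

lemma subspace_cotensor: "subspace E \<Longrightarrow> subspace (cotensor E)"
  by (auto simp: subspace_def cotensor_def)

lemma subspace_sym2: "subspace (sym2 :: ('b::real_vector ^ 'n ^ 'n::finite) set)"
  by (auto simp: subspace_def sym2_def)

lemma subspace_sym3: "subspace (sym3 :: ('b::real_vector ^ 'n ^ 'n ^ 'n::finite) set)"
  unfolding subspace_def sym3_def by simp

lemma subspace_prolong2: "subspace E \<Longrightarrow> subspace (prolong2 E)"
  by (simp add: prolong2_def subspace_inter subspace_cotensor subspace_sym2)

lemma subspace_prolong3: "subspace E \<Longrightarrow> subspace (prolong3 E)"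
  by (simp add: prolong3_def subspace_inter subspace_cotensor subspace_prolong2 subspace_sym3)

lemma subspace_wedge2:
  fixes E :: "'b::real_vector set"
  assumes "subspace E"
  shows "subspace (wedge2 E :: ('b ^ 'n ^ 'n::finite) set)"
proof -
  let ?L = "\<lambda>z :: 'b ^ 'n ^ 'n. \<chi> i j. z $ i $ j + z $ j $ i"
  have "linear ?L" by (rule linearI) (simp_all add: vec_eq_iff scaleR_add_right)
  moreover have "wedge2 E = cotensor (cotensor E) \<inter> {z. ?L z = 0}"
    by (auto simp: wedge2_def cotensor_def vec_eq_iff eq_neg_iff_add_eq_0)
  ultimately show ?thesis
    by (simp add: subspace_inter subspace_cotensor assms linear_subspace_kernel)
qed

lemma linear_spencer1: "linear spencer1"
  by (rule linearI) (simp_all add: spencer1_def vec_eq_iff scaleR_diff_right)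

lemma linear_spencer2: "linear spencer2"
  by (rule linearI) (simp_all add: spencer2_def vec_eq_iff scaleR_add_right)

lemma subspace_cocycles2:
  fixes E :: "('b::real_vector ^ 'n::finite) set"
  assumes "subspace E"
  shows "subspace (cocycles2 E)"
proof -
  have "cocycles2 E = wedge2 E \<inter> {z. spencer2 z = 0}" by (auto simp: cocycles2_def)
  then show ?thesis
    by (simp add: subspace_inter subspace_wedge2 assms linear_subspace_kernel linear_spencer2)
qed

lemma subspace_coboundaries2: "subspace E \<Longrightarrow> subspace (coboundaries2 E)"
  unfolding coboundaries2_def
  by (intro linear_subspace_image linear_spencer1 subspace_cotensor subspace_prolong2)

lemma spencer2_spencer1:
  assumes "\<zeta> \<in> cotensor sym2"
  shows "spencer2 (spencer1 \<zeta>) = 0"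
  using assms by (simp add: spencer1_def spencer2_def vec_eq_iff cotensor_def sym2_def)

lemma coboundaries2_subset_cocycles2:
  assumes "subspace E"
  shows "coboundaries2 E \<subseteq> cocycles2 E"
proof
  fix z assume "z \<in> coboundaries2 E"
  then obtain \<zeta> where z: "z = spencer1 \<zeta>" and \<zeta>: "\<zeta> \<in> cotensor (prolong2 E)"
    by (auto simp: coboundaries2_def)
  have "\<zeta> $ i $ j \<in> E" for i j using \<zeta> by (simp add: cotensor_def prolong2_def)
  then have "z \<in> wedge2 E"
    by (simp add: z wedge2_def spencer1_def subspace_diff[OF assms])
  moreover have "\<zeta> \<in> cotensor sym2" using \<zeta> by (simp add: cotensor_def prolong2_def)
  ultimately show "z \<in> cocycles2 E" by (simp add: cocycles2_def z spencer2_spencer1)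
qed

lemma spencer1_eq_0_iff: "spencer1 a = 0 \<longleftrightarrow> a \<in> sym2"
  by (auto simp: spencer1_def sym2_def vec_eq_iff)

text \<open>
  Symmetry in the last two of the three lower indices is part of membership in
  \<open>T\<^sup>*\<otimes>g\<^sub>2\<close>, and symmetry in the first two says that \<open>\<delta>\<close> vanishes. Transpositions of
  adjacent indices generate all permutations.
\<close>

lemma prolong3_eq: "prolong3 E = {\<zeta> \<in> cotensor (prolong2 E). spencer1 \<zeta> = 0}"
  unfolding spencer1_eq_0_iff
  by (auto simp: prolong3_def prolong2_def cotensor_def sym2_def sym3_def vec_eq_iff)

lemma spencer1_surj:
  assumes "z \<in> wedge2 (UNIV :: 'b::real_vector set)"
  shows "spencer1 ((- 1 / 2) *\<^sub>R z) = z"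
proof -
  have "spencer1 ((- 1 / 2) *\<^sub>R z) $ i $ j = z $ i $ j" for i j
  proof -
    have "z $ j $ i = - (z $ i $ j)" using assms unfolding wedge2_def by blast
    moreover have "(1 / 2) *\<^sub>R z $ i $ j + (1 / 2) *\<^sub>R z $ i $ j = z $ i $ j"
      by (simp flip: scaleR_add_left)
    ultimately show ?thesis by (simp add: spencer1_def)
  qed
  then show ?thesis by (simp add: vec_eq_iff)
qed

text \<open>
  Exactness in the middle is the definition of the cohomology; the content is injectivity on the left,
  where the kernel is the third prolongation.
\<close>

lemma short_exact_spencer_cohomology:
  assumes "subspace E" "prolong3 E = {0}"
  shows "short_exact (sub_space (cotensor (prolong2 E))) spencer1
    (sub_space (cocycles2 E)) (cohomology_class E) (cohomology2 E)"
proof -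
  note sub = subspace_coboundaries2[OF assms(1)]
  have "lin_map (sub_space (cotensor (prolong2 E))) (sub_space (cocycles2 E)) spencer1"
    using coboundaries2_subset_cocycles2[OF assms(1)]
    by (intro lin_map_sub_spaceI linear_spencer1) (auto simp: coboundaries2_def)
  moreover have "lin_map (sub_space (cocycles2 E)) (cohomology2 E) (cohomology_class E)"
    unfolding cohomology2_def cohomology_class_def[abs_def] by (rule lin_map_coset[OF sub])
  moreover have "inj_on spencer1 (cotensor (prolong2 E))"
    using assms(2) unfolding prolong3_eq
    by (subst linear_injective_on_subspace_0[OF linear_spencer1])
      (auto intro: subspace_cotensor subspace_prolong2 assms(1))
  moreover have "spencer1 ` cotensor (prolong2 E)
      = {z \<in> cocycles2 E. cohomology_class E z = coboundaries2 E}"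
    using coset_eq_iff[OF sub, of _ 0] coboundaries2_subset_cocycles2[OF assms(1)]
    by (auto simp: cohomology_class_def coboundaries2_def)
  ultimately show ?thesis
    by (simp add: short_exact_def sub_space_def cohomology2_def quot_space_def
        cohomology_class_def[abs_def])
qed

lemma short_exact_skew_symmetrization:
  "short_exact (sub_space (sym2 :: (real ^ 'n ^ 'n::finite) set)) (\<lambda>a. a)
    (sub_space (cotensor UNIV)) spencer1 (sub_space (wedge2 (UNIV :: real set)))"
proof -
  have "lin_map (sub_space (sym2 :: (real ^ 'n ^ 'n) set)) (sub_space (cotensor UNIV)) (\<lambda>a. a)"
    by (rule lin_map_sub_spaceI) (simp_all add: linear_ident cotensor_def)
  moreover have "lin_map (sub_space (cotensor (UNIV :: (real ^ 'n) set)))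
      (sub_space (wedge2 (UNIV :: real set))) spencer1"
    by (rule lin_map_sub_spaceI) (simp_all add: linear_spencer1 wedge2_def spencer1_def)
  moreover have "(spencer1 ` UNIV :: (real ^ 'n ^ 'n) set) = wedge2 UNIV"
  proof
    show "(spencer1 ` UNIV :: (real ^ 'n ^ 'n) set) \<subseteq> wedge2 UNIV"
      by (simp add: wedge2_def spencer1_def image_subset_iff)
    show "wedge2 UNIV \<subseteq> (spencer1 ` UNIV :: (real ^ 'n ^ 'n) set)"
      using spencer1_surj[symmetric] by blast
  qed
  ultimately show ?thesis
    by (auto simp: short_exact_def sub_space_def spencer1_eq_0_iff cotensor_def)
qed

section \<open>The Killing and conformal Killing symbols of a metric\<close>

lemma linear_trace: "linear (trace :: real ^ 'n ^ 'n::finite \<Rightarrow> real)"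
  by (rule linearI) (simp_all add: trace_def sum.distrib sum_distrib_left)

lemma trace_transpose: "trace (transpose A) = trace (A :: real ^ 'n ^ 'n::finite)"
  by (simp add: trace_def transpose_def)

lemma linear_trace2: "linear trace2"
  by (rule linearI) (simp_all add: trace2_def vec_eq_iff sum.distrib sum_distrib_left)

lemma linear_cotensor_trace2: "linear cotensor_trace2"
  by (rule linearI)
    (simp_all add: cotensor_trace2_def vec_eq_iff linear_add[OF linear_trace2]
      linear_scale[OF linear_trace2])

lemma linear_form_trace: "linear form_trace"
  by (rule linearI) (simp_all add: form_trace_def vec_eq_iff sum.distrib sum_distrib_left)

lemma linear_conf_element: "linear (conf_element w)"
  by (rule linearI)
    (simp_all add: conf_element_def vec_eq_iff sum.distrib sum_distrib_left algebra_simps)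

lemma trace2_sym2: "\<xi> \<in> sym2 \<Longrightarrow> trace2 \<xi> = (\<chi> i. trace (\<xi> $ i))"
  by (simp add: trace2_def trace_def sym2_def vec_eq_iff)

lemma form_trace_eq: "form_trace z = (\<chi> i j. trace (z $ i $ j))"
  by (simp add: form_trace_def trace_def)

text \<open>
  The lower left square of the diagram commutes because the trace may be taken over either of the two
  symmetric lower indices.
\<close>

lemma form_trace_spencer1:
  assumes "\<zeta> \<in> cotensor sym2"
  shows "form_trace (spencer1 \<zeta>) = spencer1 (cotensor_trace2 \<zeta>)"
  using assms
  by (simp add: form_trace_eq spencer1_def cotensor_trace2_def trace2_sym2 cotensor_def
      linear_diff[OF linear_trace])

lemma form_trace_in_wedge2:
  assumes "z \<in> cocycles2 E"
  shows "form_trace z \<in> wedge2 UNIV"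
proof -
  have "trace (z $ i $ j) = - trace (z $ j $ i)" for i j
  proof -
    have "z $ i $ j = - (z $ j $ i)" using assms unfolding cocycles2_def wedge2_def by blast
    then show ?thesis by (simp only: linear_neg[OF linear_trace])
  qed
  then show ?thesis
    unfolding wedge2_def form_trace_eq vec_lambda_beta mem_Collect_eq by blast
qed

text \<open>
  The factor \<open>1/n\<close> compensates for the trace n a of the conformal element of a.
\<close>

definition conformal_lift :: "real ^ 'n ^ 'n \<Rightarrow> real ^ 'n ^ 'n \<Rightarrow> real ^ 'n ^ 'n ^ 'n ^ 'n::finite"
  where "conformal_lift w b = (\<chi> i. conf_element w ((1 / real CARD('n)) *\<^sub>R b $ i))"

lemma linear_conformal_lift: "linear (conformal_lift w)"
  by (rule linearI)
    (simp_all add: conformal_lift_def vec_eq_iff linear_add[OF linear_conf_element]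
      linear_scale[OF linear_conf_element] scaleR_add_right)

locale nondegenerate_form =
  fixes w :: "real ^ 'n ^ 'n::finite"
  assumes symmetric_form: "transpose w = w" and invertible_form: "invertible w"
begin

abbreviation v :: "real ^ 'n ^ 'n" where "v \<equiv> matrix_inv w"

lemma w_v: "w ** v = mat 1" and v_w: "v ** w = mat 1"
  using invertible_form by (simp_all add: matrix_inv_works)

lemma w_sym: "w $ i $ j = w $ j $ i"
  using arg_cong[OF symmetric_form, of "\<lambda>A. A $ j $ i"] by (simp add: transpose_def)

lemma v_transpose: "transpose v = v"
proof -
  have "transpose v ** w = mat 1"
    using arg_cong[OF w_v, of transpose] by (simp add: matrix_transpose_mul symmetric_form)
  then have "transpose v ** (w ** v) = v" by (simp add: matrix_mul_assoc)
  then show ?thesis by (simp add: w_v)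
qed

text \<open>
  Lowering the upper index is multiplication by \<open>w\<close> on the right; \<open>g\<^sub>1\<close> then consists of the
  endomorphisms whose lowered form is skew.
\<close>

lemma symmetrized_lowering:
  "(\<Sum>r\<in>UNIV. w $ r $ j * \<xi> $ i $ r) + (\<Sum>r\<in>UNIV. w $ i $ r * \<xi> $ j $ r)
    = (\<xi> ** w + transpose (\<xi> ** w)) $ i $ j"
proof -
  have "w $ i $ r = w $ r $ i" for r by (rule w_sym)
  then show ?thesis by (simp add: transpose_def matrix_matrix_mult_def mult.commute)
qed

lemma killing_iff: "\<xi> \<in> killing_symbol w \<longleftrightarrow> \<xi> ** w + transpose (\<xi> ** w) = 0"
  by (simp only: killing_symbol_def symmetrized_lowering mem_Collect_eq vec_eq_iff zero_index)

text \<open>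
  The multiples of the identity are lowered to multiples of the metric, so removing the trace part
  removes exactly the term by which the conformal equations differ from the Killing equations.
\<close>

lemma conf_killing_iff:
  "\<xi> \<in> conf_killing_symbol w \<longleftrightarrow> \<xi> - (trace \<xi> / real CARD('n)) *\<^sub>R mat 1 \<in> killing_symbol w"
proof -
  have lower: "((\<xi> - c *\<^sub>R mat 1) ** w) $ i $ j = (\<xi> ** w) $ i $ j - c * w $ i $ j" for c i j
    by (simp add: matrix_matrix_mult_def mat_def left_diff_distrib sum_subtractf
        if_distrib[of "\<lambda>x. _ * x"] if_distrib[of "\<lambda>x. x * _"] cong: if_cong)
  have rescale: "2 / real CARD('n) * w $ i $ j * (\<Sum>r\<in>UNIV. \<xi> $ r $ r)
      = 2 * (trace \<xi> / real CARD('n)) * w $ i $ j" for i j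
    by (simp add: trace_def)
  have "\<xi> \<in> conf_killing_symbol w \<longleftrightarrow>
      (\<forall>i j. (\<xi> ** w + transpose (\<xi> ** w)) $ i $ j - 2 * (trace \<xi> / real CARD('n)) * w $ i $ j = 0)"
    by (simp only: conf_killing_symbol_def mem_Collect_eq symmetrized_lowering flip: rescale)
  also have "\<dots> \<longleftrightarrow> \<xi> - (trace \<xi> / real CARD('n)) *\<^sub>R mat 1 \<in> killing_symbol w"
  proof -
    have "((\<xi> - c *\<^sub>R mat 1) ** w + transpose ((\<xi> - c *\<^sub>R mat 1) ** w)) $ i $ j
      = (\<xi> ** w + transpose (\<xi> ** w)) $ i $ j - 2 * c * w $ i $ j" for c i j
      using w_sym[of i j] by (simp add: transpose_def lower)
    then show ?thesis unfolding killing_iff vec_eq_iff zero_index by presburger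
  qed
  finally show ?thesis .
qed

lemma subspace_killing: "subspace (killing_symbol w)"
proof -
  have "linear (\<lambda>\<xi> :: real ^ 'n ^ 'n. \<xi> ** w + transpose (\<xi> ** w))"
    by (rule linearI)
      (simp_all add: vec_eq_iff matrix_matrix_mult_def transpose_def sum.distrib
        sum_distrib_left algebra_simps)
  from linear_subspace_kernel[OF this] show ?thesis by (simp add: killing_iff[abs_def, symmetric])
qed

lemma subspace_conf_killing: "subspace (conf_killing_symbol w)"
proof -
  have l: "linear (\<lambda>\<xi> :: real ^ 'n ^ 'n. \<xi> - (trace \<xi> / real CARD('n)) *\<^sub>R mat 1)"
    by (rule linearI)
      (simp_all add: linear_add[OF linear_trace] linear_scale[OF linear_trace] add_divide_distrib
        scaleR_add_left scaleR_diff_right)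
  have "conf_killing_symbol w
      = (\<lambda>\<xi>. \<xi> - (trace \<xi> / real CARD('n)) *\<^sub>R mat 1) -` killing_symbol w"
    by (auto simp: conf_killing_iff)
  then show ?thesis using linear_subspace_vimage[OF l subspace_killing] by simp
qed

text \<open>
  The trace pairs the lowered tensor, which is skew, with the symmetric inverse metric.
\<close>

lemma trace_killing:
  assumes "\<xi> \<in> killing_symbol w"
  shows "trace \<xi> = 0"
proof -
  let ?L = "\<xi> ** w"
  have L: "transpose ?L = - ?L"
    using assms by (simp add: killing_iff eq_neg_iff_add_eq_0 add.commute)
  have \<xi>: "\<xi> = ?L ** v" by (simp add: matrix_mul_assoc[symmetric] w_v)
  have "trace (?L ** v) = trace (transpose (?L ** v))" by (simp only: trace_transpose)
  also have "\<dots> = trace (v ** (- ?L))"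
    by (subst matrix_transpose_mul) (simp only: v_transpose L)
  also have "\<dots> = trace ((- ?L) ** v)" by (rule trace_mul_sym)
  also have "\<dots> = - trace (?L ** v)"
    by (simp add: trace_def matrix_matrix_mult_def sum_negf)
  finally show ?thesis using \<xi> by simp
qed

lemma killing_iff_conf_trace:
  "\<xi> \<in> killing_symbol w \<longleftrightarrow> \<xi> \<in> conf_killing_symbol w \<and> trace \<xi> = 0"
  using trace_killing by (auto simp: conf_killing_iff)

lemma killing_subset_conf: "killing_symbol w \<subseteq> conf_killing_symbol w"
  using killing_iff_conf_trace by blast

text \<open>
  With the upper index lowered, an element is symmetric in its first two and skew in its last two
  indices; going round the six permutations of the indices shows that it equals its negative.
\<close>

lemma prolong2_killing: "prolong2 (killing_symbol w) = {0}"
proof -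
  have "\<xi> = 0" if "\<xi> \<in> prolong2 (killing_symbol w)" for \<xi> :: "real ^ 'n ^ 'n ^ 'n"
  proof -
    define L where "L i j k = (\<xi> $ i ** w) $ j $ k" for i j k
    have sym: "L i j k = L j i k" for i j k
      using that by (simp add: L_def matrix_matrix_mult_def prolong2_def sym2_def)
    have anti: "L i j k = - L i k j" for i j k
    proof -
      have "\<xi> $ i ** w + transpose (\<xi> $ i ** w) = 0"
        using that by (simp add: prolong2_def cotensor_def killing_iff)
      then have "(\<xi> $ i ** w + transpose (\<xi> $ i ** w)) $ j $ k = 0" by simp
      then show ?thesis by (simp add: L_def transpose_def)
    qed
    have "L i j k = 0" for i j k
      using sym[of i j k] anti[of j i k] sym[of j k i] anti[of k j i] sym[of k i j] anti[of i k j]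
      by linarith
    then have "\<xi> $ i ** w = 0" for i by (simp add: L_def vec_eq_iff)
    then have "\<xi> $ i ** (w ** v) = 0" for i by (simp add: matrix_mul_assoc)
    then show ?thesis by (simp add: w_v vec_eq_iff)
  qed
  moreover have "0 \<in> prolong2 (killing_symbol w)"
    by (intro subspace_0 subspace_prolong2 subspace_killing)
  ultimately show ?thesis by blast
qed

text \<open>
  Lowering the index of \<open>\<delta>\<^sup>k\<^sub>i a\<^sub>j - w\<^sub>i\<^sub>j w\<^sup>k\<^sup>r a\<^sub>r\<close> gives
  \<open>w\<^sub>i\<^sub>l a\<^sub>j - w\<^sub>i\<^sub>j a\<^sub>l\<close>, which is skew in j and l (here \<open>\<delta>\<close> is the Kronecker symbol). That the conformal elements lie in
  \<open>T\<^sup>*\<otimes>\<gamma>\<^sub>1\<close> and have trace n a both follow from this.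
\<close>

lemma conf_element_trace_free: 
  "conf_element w a $ i - (a $ i) *\<^sub>R mat 1 \<in> killing_symbol w" (is "?M \<in> _")
proof -
  have wva: "(\<Sum>k\<in>UNIV. (\<Sum>r\<in>UNIV. v $ k $ r * a $ r) * w $ k $ l) = a $ l" for l
  proof -
    have "(w *v (v *v a)) $ l = a $ l" by (simp add: matrix_vector_mul_assoc w_v)
    then show ?thesis by (simp add: matrix_vector_mult_def mult.commute w_sym)
  qed
  have "(?M ** w) $ j $ l = a $ j * w $ i $ l - w $ i $ j * a $ l" for j l
  proof -
    have "(?M ** w) $ j $ l = (\<Sum>k\<in>UNIV. (if k = i then a $ j * w $ i $ l else 0)
        - w $ i $ j * ((\<Sum>r\<in>UNIV. v $ k $ r * a $ r) * w $ k $ l))"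
      by (simp add: matrix_matrix_mult_def conf_element_def mat_def)
        (rule sum.cong, auto simp: algebra_simps)
    also have "\<dots> = a $ j * w $ i $ l - w $ i $ j * a $ l"
      by (simp add: sum_subtractf sum_distrib_left[symmetric] wva)
    finally show ?thesis .
  qed
  then show ?thesis
    by (simp add: killing_iff vec_eq_iff transpose_def mult.commute)
qed

lemma trace_conf_element: "trace (conf_element w a $ i) = real CARD('n) * a $ i"
  using trace_killing[OF conf_element_trace_free, of a i]
  by (simp add: linear_diff[OF linear_trace] linear_scale[OF linear_trace] trace_I)

lemma conf_element_sym2: "conf_element w a \<in> sym2"
  by (auto simp: sym2_def conf_element_def vec_eq_iff w_sym)

lemma trace2_conf_element: "trace2 (conf_element w a) = real CARD('n) *\<^sub>R a"
  by (simp add: trace2_sym2[OF conf_element_sym2] trace_conf_element vec_eq_iff)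

lemma conf_element_prolong2: "conf_element w a \<in> prolong2 (conf_killing_symbol w)"
  using conf_element_trace_free
  by (simp add: prolong2_def conf_element_sym2 cotensor_def conf_killing_iff trace_conf_element)

text \<open>
  The difference of the two sides has trace zero, hence lies in the prolongation of the Killing
  symbol, which vanishes.
\<close>

lemma conf_element_trace2:
  assumes "\<xi> \<in> prolong2 (conf_killing_symbol w)"
  shows "conf_element w ((1 / real CARD('n)) *\<^sub>R trace2 \<xi>) = \<xi>"
proof -
  let ?\<eta> = "\<xi> - conf_element w ((1 / real CARD('n)) *\<^sub>R trace2 \<xi>)"
  have \<eta>: "?\<eta> \<in> prolong2 (conf_killing_symbol w)"
    by (intro subspace_diff subspace_prolong2 subspace_conf_killing assms conf_element_prolong2)
  then have "(\<chi> i. trace (?\<eta> $ i)) = trace2 ?\<eta>"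
    by (simp only: prolong2_def Int_iff trace2_sym2)
  also have "\<dots> = 0" by (simp add: linear_diff[OF linear_trace2] trace2_conf_element)
  finally have "trace (?\<eta> $ i) = 0" for i by (simp only: vec_eq_iff vec_lambda_beta zero_index)
  with \<eta> have "?\<eta> \<in> prolong2 (killing_symbol w)"
    by (simp only: prolong2_def cotensor_def Int_iff mem_Collect_eq killing_iff_conf_trace simp_thms)
  then show ?thesis by (simp add: prolong2_killing)
qed

lemma prolong2_conf_killing: "prolong2 (conf_killing_symbol w) = range (conf_element w)"
  using conf_element_prolong2 conf_element_trace2[symmetric] by blast

lemma conformal_lift_in: "conformal_lift w b \<in> cotensor (prolong2 (conf_killing_symbol w))"
  by (simp add: cotensor_def conformal_lift_def conf_element_prolong2)

lemma conformal_lift_sym2: "conformal_lift w b \<in> cotensor sym2"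
  by (simp add: cotensor_def conformal_lift_def conf_element_sym2)

lemma cotensor_trace2_conformal_lift: "cotensor_trace2 (conformal_lift w b) = b"
  by (simp add: cotensor_trace2_def conformal_lift_def trace2_conf_element vec_eq_iff)

lemma conformal_lift_cotensor_trace2:
  "\<zeta> \<in> cotensor (prolong2 (conf_killing_symbol w)) \<Longrightarrow> conformal_lift w (cotensor_trace2 \<zeta>) = \<zeta>"
  by (simp add: conformal_lift_def cotensor_trace2_def cotensor_def conf_element_trace2 vec_eq_iff)

lemma form_trace_spencer1_conformal_lift: "form_trace (spencer1 (conformal_lift w b)) = spencer1 b"
  by (simp add: form_trace_spencer1 conformal_lift_sym2 cotensor_trace2_conformal_lift)

text \<open>
  Contraction of the form index with the upper index. On an element of the third prolongation it
  agrees with the contraction of a lower index with the upper one, and the comparison forces the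
  element to vanish.
\<close>

lemma contracted_conformal_lift:
  "(\<Sum>j\<in>UNIV. conformal_lift w b $ j $ i $ l $ j)
    = (b $ i $ l + b $ l $ i - w $ i $ l * trace (v ** transpose b)) / real CARD('n)"
proof -
  have "(\<Sum>j\<in>UNIV. conformal_lift w b $ j $ i $ l $ j)
    = (\<Sum>j\<in>UNIV. (if j = i then b $ i $ l / real CARD('n) else 0) + (if j = l then b $ l $ i / real CARD('n) else 0)
        - w $ i $ l / real CARD('n) * (\<Sum>r\<in>UNIV. v $ j $ r * b $ j $ r))"
    by (rule sum.cong) (auto simp: conformal_lift_def conf_element_def sum_distrib_left)
  also have "\<dots> = b $ i $ l / real CARD('n) + b $ l $ i / real CARD('n) - w $ i $ l / real CARD('n) * trace (v ** transpose b)"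
    by (simp add: sum_subtractf sum.distrib sum_distrib_left sum_divide_distrib trace_def
        matrix_matrix_mult_def transpose_def)
  finally show ?thesis by (simp add: diff_divide_distrib add_divide_distrib)
qed

lemma prolong3_conf_killing:
  assumes "CARD('n) \<ge> 3"
  shows "prolong3 (conf_killing_symbol w) = {0}"
proof -
  have n: "real CARD('n) \<ge> 3" using assms by simp
  have "\<zeta> = 0" if "\<zeta> \<in> prolong3 (conf_killing_symbol w)" for \<zeta> :: "real ^ 'n ^ 'n ^ 'n ^ 'n"
  proof -
    define b where "b = cotensor_trace2 \<zeta>"
    have \<zeta>: "\<zeta> \<in> cotensor (prolong2 (conf_killing_symbol w))" and closed: "spencer1 \<zeta> = 0"
      using that by (simp_all add: prolong3_eq)
    have lift: "\<zeta> = conformal_lift w b"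
      using conformal_lift_cotensor_trace2[OF \<zeta>] by (simp add: b_def)
    have "spencer1 b = 0"
      using form_trace_spencer1_conformal_lift[of b] closed lift
      by (simp add: linear_0[OF linear_form_trace])
    then have b_sym: "b $ i $ j = b $ j $ i" for i j
      unfolding spencer1_eq_0_iff sym2_def by blast
    have \<zeta>_sym: "\<zeta> $ i $ j = \<zeta> $ j $ i" for i j
      using closed unfolding spencer1_eq_0_iff sym2_def by blast
    define \<beta> where "\<beta> = trace (v ** transpose b)"
    \<comment> \<open>Symmetry allows to compute the trace over the form index instead, so that the right hand side
        of the contraction formula equals b.\<close>
    have eq: "(real CARD('n) - 2) * b $ i $ l = - \<beta> * w $ i $ l" for i l
    proof -
      have "b $ i $ l = (\<Sum>j\<in>UNIV. \<zeta> $ i $ j $ l $ j)"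
        by (simp add: b_def cotensor_trace2_def trace2_def)
      also have "\<dots> = (\<Sum>j\<in>UNIV. conformal_lift w b $ j $ i $ l $ j)"
        by (simp only: \<zeta>_sym[of i] flip: lift)
      also have "\<dots> = (b $ i $ l + b $ l $ i - w $ i $ l * \<beta>) / real CARD('n)"
        by (simp add: contracted_conformal_lift \<beta>_def)
      finally show ?thesis using b_sym[of l i] n by (simp add: field_simps)
    qed
    have "(real CARD('n) - 2) * \<beta> = trace (v ** transpose ((real CARD('n) - 2) *\<^sub>R b))"
      by (simp add: \<beta>_def trace_def matrix_matrix_mult_def transpose_def sum_distrib_left
          algebra_simps)
    also have "(real CARD('n) - 2) *\<^sub>R b = (- \<beta>) *\<^sub>R w" using eq by (simp add: vec_eq_iff)
    also have "trace (v ** transpose ((- \<beta>) *\<^sub>R w)) = - \<beta> * trace (v ** transpose w)"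
      by (simp add: trace_def matrix_matrix_mult_def transpose_def sum_distrib_left
          algebra_simps sum_negf)
    also have "\<dots> = - \<beta> * real CARD('n)" by (simp add: symmetric_form v_w trace_I)
    finally have "(2 * real CARD('n) - 2) * \<beta> = 0" by (simp add: algebra_simps)
    then have "\<beta> = 0" using n by simp
    with eq n have "b = 0" by (simp add: vec_eq_iff)
    then show ?thesis using lift by (simp add: linear_0[OF linear_conformal_lift])
  qed
  moreover have "0 \<in> prolong3 (conf_killing_symbol w)"
    by (intro subspace_0 subspace_prolong3 subspace_conf_killing)
  ultimately show ?thesis by blast
qed

end

section \<open>The connecting map\<close>

text \<open>
  The part of a curvature tensor built from a symmetric tensor b and the metric, like the Schouten
  part in the Weyl decomposition; here it arises as the snake lemma's lift of b.
\<close>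

definition schouten_cocycle :: "real ^ 'n ^ 'n \<Rightarrow> real ^ 'n ^ 'n \<Rightarrow> real ^ 'n ^ 'n ^ 'n ^ 'n::finite"
  where "schouten_cocycle w b = spencer1 (conformal_lift w b)"

lemma linear_schouten_cocycle: "linear (schouten_cocycle w)"
  using linear_compose[OF linear_conformal_lift linear_spencer1]
  by (simp add: comp_def schouten_cocycle_def[abs_def])

context nondegenerate_form
begin

lemma cocycles2_killing_iff:
  "z \<in> cocycles2 (killing_symbol w) \<longleftrightarrow>
    z \<in> cocycles2 (conf_killing_symbol w) \<and> form_trace z = 0"
proof -
  have "form_trace z = 0 \<longleftrightarrow> (\<forall>i j. trace (z $ i $ j) = 0)"
    by (simp add: form_trace_eq vec_eq_iff)
  then show ?thesis
    unfolding cocycles2_def wedge2_def mem_Collect_eq killing_iff_conf_trace by blast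
qed

lemma coboundaries2_killing: "coboundaries2 (killing_symbol w) = {0}"
proof -
  have "cotensor {0} = ({0} :: (real ^ 'n ^ 'n ^ 'n ^ 'n) set)"
    by (auto simp: cotensor_def vec_eq_iff)
  then show ?thesis
    by (simp add: coboundaries2_def prolong2_killing linear_0[OF linear_spencer1])
qed

text \<open>
  As \<open>g\<^sub>2 = 0\<close>, cohomology classes of the Killing symbol are singletons.
\<close>

lemma cohomology_class_killing: "cohomology_class (killing_symbol w) z = {z}"
  by (simp add: cohomology_class_def coboundaries2_killing elt_set_plus_def)

lemma carr_cohomology2_killing:
  "carr (cohomology2 (killing_symbol w)) = (\<lambda>z. {z}) ` cocycles2 (killing_symbol w)"
  by (simp add: cohomology2_def quot_space_def coboundaries2_killing elt_set_plus_def)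

lemma lin_map_class_killing:
  "lin_map (sub_space (cocycles2 (killing_symbol w))) (cohomology2 (killing_symbol w))
    (cohomology_class (killing_symbol w))"
  unfolding cohomology2_def cohomology_class_def[abs_def]
  by (intro lin_map_coset subspace_coboundaries2 subspace_killing)

lemma lin_iso_class_killing:
  "lin_iso (sub_space (cocycles2 (killing_symbol w))) (cohomology2 (killing_symbol w))
    (cohomology_class (killing_symbol w))"
  using lin_map_class_killing
  by (simp add: lin_iso_def bij_betw_def inj_on_def carr_cohomology2_killing
      cohomology_class_killing sub_space_def)

lemma lin_iso_trace2:
  "lin_iso (sub_space (prolong2 (conf_killing_symbol w))) (sub_space UNIV) trace2"
proof -
  have "bij_betw trace2 (prolong2 (conf_killing_symbol w)) UNIV"
    by (rule bij_betw_byWitness[where f' = "\<lambda>a. conf_element w ((1 / real CARD('n)) *\<^sub>R a)"])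
      (auto simp: conf_element_trace2 trace2_conf_element conf_element_prolong2)
  then show ?thesis
    by (simp add: lin_iso_def lin_map_sub_spaceI linear_trace2) (simp add: sub_space_def)
qed

lemma lin_iso_cotensor_trace2:
  "lin_iso (sub_space (cotensor (prolong2 (conf_killing_symbol w))))
    (sub_space (cotensor UNIV)) cotensor_trace2"
proof -
  have "bij_betw cotensor_trace2 (cotensor (prolong2 (conf_killing_symbol w))) (cotensor UNIV)"
    by (rule bij_betw_byWitness[where f' = "conformal_lift w"])
      (auto simp: conformal_lift_cotensor_trace2 cotensor_trace2_conformal_lift
        conformal_lift_in, simp_all add: cotensor_def)
  moreover have "lin_map (sub_space (cotensor (prolong2 (conf_killing_symbol w))))
      (sub_space (cotensor UNIV)) cotensor_trace2"
    by (rule lin_map_sub_spaceI[OF linear_cotensor_trace2]) (simp add: cotensor_def)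
  ultimately show ?thesis by (simp add: lin_iso_def sub_space_def)
qed

lemma form_trace_schouten_cocycle: "form_trace (schouten_cocycle w b) = spencer1 b"
  by (simp add: schouten_cocycle_def form_trace_spencer1_conformal_lift)

lemma schouten_cocycle_coboundary: "schouten_cocycle w b \<in> coboundaries2 (conf_killing_symbol w)"
  by (simp add: schouten_cocycle_def coboundaries2_def conformal_lift_in)

lemma schouten_cocycle_conf: "schouten_cocycle w b \<in> cocycles2 (conf_killing_symbol w)"
  using schouten_cocycle_coboundary coboundaries2_subset_cocycles2[OF subspace_conf_killing] by blast

text \<open>
  The trace of the Schouten cocycle of b is the skew-symmetrization of b.
\<close>

lemma schouten_cocycle_killing:
  "schouten_cocycle w b \<in> cocycles2 (killing_symbol w) \<longleftrightarrow> b \<in> sym2"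
  by (simp add: cocycles2_killing_iff schouten_cocycle_conf form_trace_schouten_cocycle
      spencer1_eq_0_iff)

lemma exact_middle_column:
  "short_exact (sub_space (cocycles2 (killing_symbol w))) (\<lambda>z. z)
    (sub_space (cocycles2 (conf_killing_symbol w))) form_trace (sub_space (wedge2 UNIV))"
proof -
  have "lin_map (sub_space (cocycles2 (killing_symbol w)))
      (sub_space (cocycles2 (conf_killing_symbol w))) (\<lambda>z. z)"
    by (rule lin_map_sub_spaceI) (simp_all add: linear_ident cocycles2_killing_iff)
  moreover have "lin_map (sub_space (cocycles2 (conf_killing_symbol w)))
      (sub_space (wedge2 UNIV)) form_trace"
    by (intro lin_map_sub_spaceI linear_form_trace form_trace_in_wedge2)
  moreover have "form_trace ` cocycles2 (conf_killing_symbol w) = wedge2 UNIV"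
  proof
    show "form_trace ` cocycles2 (conf_killing_symbol w) \<subseteq> wedge2 UNIV"
      using form_trace_in_wedge2 by blast
    show "wedge2 UNIV \<subseteq> form_trace ` cocycles2 (conf_killing_symbol w)"
    proof
      fix z :: "real ^ 'n ^ 'n" assume "z \<in> wedge2 UNIV"
      then have "form_trace (schouten_cocycle w ((- 1 / 2) *\<^sub>R z)) = z"
        by (simp only: form_trace_schouten_cocycle spencer1_surj)
      then show "z \<in> form_trace ` cocycles2 (conf_killing_symbol w)"
        using imageI[OF schouten_cocycle_conf] by metis
    qed
  qed
  moreover have "cocycles2 (killing_symbol w)
      = {z \<in> cocycles2 (conf_killing_symbol w). form_trace z = 0}"
    using cocycles2_killing_iff by blast
  ultimately show ?thesis by (simp add: short_exact_def sub_space_def)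
qed

lemma cohomology_incl_class:
  "cohomology_incl (conf_killing_symbol w) (cohomology_class (killing_symbol w) z)
    = cohomology_class (conf_killing_symbol w) z"
  unfolding cohomology_class_killing
  by (simp add: cohomology_incl_def cohomology_class_def set_plus_def elt_set_plus_def)

lemma cohomology_class_conf_eq_iff:
  "cohomology_class (conf_killing_symbol w) z = cohomology_class (conf_killing_symbol w) z'
    \<longleftrightarrow> z - z' \<in> coboundaries2 (conf_killing_symbol w)"
  unfolding cohomology_class_def
  by (intro coset_eq_iff subspace_coboundaries2 subspace_conf_killing)

lemma lin_map_schouten_class:
  "lin_map (sub_space sym2) (cohomology2 (killing_symbol w))
    (\<lambda>b. cohomology_class (killing_symbol w) (schouten_cocycle w b))"
proof (rule lin_map_comp[OF _ lin_map_class_killing])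
  show "lin_map (sub_space sym2) (sub_space (cocycles2 (killing_symbol w))) (schouten_cocycle w)"
    by (rule lin_map_sub_spaceI) (simp_all add: linear_schouten_cocycle schouten_cocycle_killing)
qed

text \<open>
  A coboundary \<open>\<delta>\<zeta>\<close> is the Schouten cocycle of the trace of \<open>\<zeta>\<close>, because
  \<open>\<zeta>\<close> is the lift of its trace; it has values in \<open>g\<^sub>1\<close> exactly when that trace is
  symmetric.
\<close>

lemma cocycle_killing_coboundary_conf_iff:
  "z \<in> cocycles2 (killing_symbol w) \<and> z \<in> coboundaries2 (conf_killing_symbol w)
    \<longleftrightarrow> z \<in> schouten_cocycle w ` sym2"
proof
  assume z: "z \<in> cocycles2 (killing_symbol w) \<and> z \<in> coboundaries2 (conf_killing_symbol w)"
  then obtain \<zeta> where "z = spencer1 \<zeta>" "\<zeta> \<in> cotensor (prolong2 (conf_killing_symbol w))"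
    by (auto simp: coboundaries2_def)
  then have "z = schouten_cocycle w (cotensor_trace2 \<zeta>)"
    by (simp add: schouten_cocycle_def conformal_lift_cotensor_trace2)
  with z schouten_cocycle_killing show "z \<in> schouten_cocycle w ` sym2" by blast
next
  assume "z \<in> schouten_cocycle w ` sym2"
  then show "z \<in> cocycles2 (killing_symbol w) \<and> z \<in> coboundaries2 (conf_killing_symbol w)"
    using schouten_cocycle_killing schouten_cocycle_coboundary by blast
qed

lemma exact_right_column:
  assumes "CARD('n) \<ge> 3"
  shows "short_exact (sub_space sym2)
    (\<lambda>b. cohomology_class (killing_symbol w) (schouten_cocycle w b))
    (cohomology2 (killing_symbol w)) (cohomology_incl (conf_killing_symbol w))
    (cohomology2 (conf_killing_symbol w))"
proof -
  let ?g = "killing_symbol w" and ?h = "conf_killing_symbol w"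
  have sub: "cocycles2 ?g \<subseteq> cocycles2 ?h" using cocycles2_killing_iff by blast
  have "lin_map (cohomology2 ?g) (cohomology2 ?h) (cohomology_incl ?h)"
    unfolding cohomology2_def cohomology_incl_def[abs_def]
  proof (rule lin_map_enlarge_cosets)
    show "coboundaries2 ?g \<subseteq> coboundaries2 ?h"
      using subspace_0[OF subspace_coboundaries2[OF subspace_conf_killing]]
      by (simp add: coboundaries2_killing)
  qed (intro subspace_coboundaries2 subspace_killing subspace_conf_killing sub)+
  moreover have "inj_on (\<lambda>b. cohomology_class ?g (schouten_cocycle w b)) sym2"
  proof (rule inj_onI)
    fix b b'
    assume "cohomology_class ?g (schouten_cocycle w b) = cohomology_class ?g (schouten_cocycle w b')"
    then have "spencer1 (conformal_lift w b) = spencer1 (conformal_lift w b')" (is "?eq")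
      by (simp add: cohomology_class_killing schouten_cocycle_def)
    have "inj_on spencer1 (cotensor (prolong2 ?h))"
      using short_exact_spencer_cohomology[OF subspace_conf_killing prolong3_conf_killing[OF assms]]
      by (simp add: short_exact_def sub_space_def)
    then have "conformal_lift w b = conformal_lift w b'"
      using \<open>?eq\<close> by (rule inj_onD[OF _ _ conformal_lift_in conformal_lift_in])
    then have "cotensor_trace2 (conformal_lift w b) = cotensor_trace2 (conformal_lift w b')"
      by simp
    then show "b = b'" by (simp add: cotensor_trace2_conformal_lift)
  qed
  moreover have "(\<lambda>b. cohomology_class ?g (schouten_cocycle w b)) ` sym2
      = {C \<in> carr (cohomology2 ?g). cohomology_incl ?h C = coboundaries2 ?h}"
  proof -
    have kernel: "cohomology_class ?h z = coboundaries2 ?h \<longleftrightarrow> z \<in> coboundaries2 ?h" for z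
      using cohomology_class_conf_eq_iff[of z 0] by (simp add: cohomology_class_def)
    have "{y \<in> f ` A. P y} = f ` {x \<in> A. P (f x)}" for f :: "'c \<Rightarrow> 'd" and A P by auto
    then have "{C \<in> carr (cohomology2 ?g). cohomology_incl ?h C = coboundaries2 ?h}
        = cohomology_class ?g ` {z \<in> cocycles2 ?g.
            cohomology_incl ?h (cohomology_class ?g z) = coboundaries2 ?h}"
      unfolding carr_cohomology2_killing cohomology_class_killing .
    also have "\<dots> = cohomology_class ?g ` {z \<in> cocycles2 ?g. z \<in> coboundaries2 ?h}"
      by (simp only: cohomology_incl_class kernel)
    also have "{z \<in> cocycles2 ?g. z \<in> coboundaries2 ?h} = schouten_cocycle w ` sym2"
      using cocycle_killing_coboundary_conf_iff by blast
    finally show ?thesis by (simp add: image_image)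
  qed
  moreover have "cohomology_incl ?h ` carr (cohomology2 ?g) = carr (cohomology2 ?h)"
  proof
    show "cohomology_incl ?h ` carr (cohomology2 ?g) \<subseteq> carr (cohomology2 ?h)"
      using \<open>lin_map (cohomology2 ?g) (cohomology2 ?h) (cohomology_incl ?h)\<close>
      unfolding lin_map_def by blast
    show "carr (cohomology2 ?h) \<subseteq> cohomology_incl ?h ` carr (cohomology2 ?g)"
    proof
      fix C assume "C \<in> carr (cohomology2 ?h)"
      then obtain z where z: "z \<in> cocycles2 ?h" and C: "C = cohomology_class ?h z"
        by (auto simp: cohomology2_def quot_space_def cohomology_class_def)
      \<comment> \<open>This preimage of the trace under skew-symmetrization makes the Schouten cocycle cancel it.\<close>
      define b where "b = (- 1 / 2) *\<^sub>R form_trace z"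
      have "form_trace z \<in> wedge2 UNIV"
        using z by (rule form_trace_in_wedge2)
      then have "form_trace (z - schouten_cocycle w b) = 0"
        by (simp only: linear_diff[OF linear_form_trace] form_trace_schouten_cocycle b_def
            spencer1_surj diff_self)
      moreover have "z - schouten_cocycle w b \<in> cocycles2 ?h"
        by (intro subspace_diff subspace_cocycles2 subspace_conf_killing z schouten_cocycle_conf)
      ultimately have "z - schouten_cocycle w b \<in> cocycles2 ?g" by (simp add: cocycles2_killing_iff)
      then have "cohomology_class ?g (z - schouten_cocycle w b) \<in> carr (cohomology2 ?g)"
        unfolding carr_cohomology2_killing cohomology_class_killing by (rule imageI)
      moreover have "C = cohomology_incl ?h (cohomology_class ?g (z - schouten_cocycle w b))"
        using schouten_cocycle_coboundary
        by (simp add: C cohomology_incl_class cohomology_class_conf_eq_iff)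
      ultimately show "C \<in> cohomology_incl ?h ` carr (cohomology2 ?g)" by (rule rev_image_eqI)
    qed
  qed
  ultimately show ?thesis
    using lin_map_schouten_class
    by (simp add: short_exact_def) (simp add: sub_space_def cohomology2_def quot_space_def)
qed

end

text \<open>
  The Schouten cocycle is a sum of such products, and a change of components acts on each factor
  separately.
\<close>

definition skew_product :: "real ^ 'n ^ 'n \<Rightarrow> real ^ 'n ^ 'n \<Rightarrow> real ^ 'n ^ 'n ^ 'n ^ 'n::finite"
  where "skew_product M N = (\<chi> i j s k. M $ i $ k * N $ j $ s - M $ j $ k * N $ i $ s)"

text \<open>
  Skew-symmetrizing the lift kills the Kronecker term \<open>\<delta>\<^sup>k\<^sub>s b\<^sub>j\<^sub>i\<close>, by symmetry of b.
\<close>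

lemma (in nondegenerate_form) schouten_cocycle_eq_skew_product:
  assumes "b \<in> sym2"
  shows "schouten_cocycle w b
    = (1 / real CARD('n)) *\<^sub>R (skew_product (mat 1) b + skew_product (b ** v) w)"
proof -
  have b: "b $ j $ i = b $ i $ j" for i j using assms unfolding sym2_def by blast
  have bv: "(b ** v) $ j $ k = (\<Sum>r\<in>UNIV. v $ k $ r * b $ j $ r)" for j k
  proof -
    have "v $ r $ k = v $ k $ r" for r
      using arg_cong[OF v_transpose, of "\<lambda>A. A $ k $ r"] by (simp add: transpose_def)
    then show ?thesis by (simp add: matrix_matrix_mult_def mult.commute)
  qed
  have lift: "conformal_lift w b $ j $ i $ s $ k = (1 / real CARD('n)) *
      (mat 1 $ i $ k * b $ j $ s + mat 1 $ s $ k * b $ j $ i - (b ** v) $ j $ k * w $ i $ s)"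
    for i j s k
    by (simp add: conformal_lift_def conf_element_def bv mat_def right_diff_distrib
        distrib_left sum_divide_distrib sum_distrib_left mult_ac)
  have "schouten_cocycle w b $ i $ j $ s $ k
    = ((1 / real CARD('n)) *\<^sub>R (skew_product (mat 1) b + skew_product (b ** v) w)) $ i $ j $ s $ k"
    for i j s k
    using b[of j i] by (simp add: schouten_cocycle_def spencer1_def lift skew_product_def
        algebra_simps diff_divide_distrib add_divide_distrib)
  then show ?thesis by (simp add: vec_eq_iff)
qed

lemma linear_change_form2: "linear (change_form2 P)"
  by (rule linearI)
    (simp_all add: change_form2_def vec_eq_iff sum.distrib sum_distrib_left algebra_simps)

text \<open>
  The fourfold sum factors into one double sum for each factor of the product.
\<close>

lemma change_form2_skew_product:
  fixes P :: "real ^ 'n ^ 'n::finite"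
  shows "change_form2 P (skew_product M N)
    = skew_product (transpose P ** M ** transpose (matrix_inv P)) (transpose P ** N ** P)"
proof -
  let ?Q = "matrix_inv P"
  have M: "(transpose P ** M ** transpose ?Q) $ i $ k
      = (\<Sum>i'\<in>UNIV. \<Sum>k'\<in>UNIV. P $ i' $ i * ?Q $ k $ k' * M $ i' $ k')" for i k
    by (subst sum.swap)
      (simp add: matrix_matrix_mult_def transpose_def sum_distrib_left sum_distrib_right mult_ac)
  have N: "(transpose P ** N ** P) $ j $ s
      = (\<Sum>j'\<in>UNIV. \<Sum>s'\<in>UNIV. P $ j' $ j * P $ s' $ s * N $ j' $ s')" for j s
    by (subst sum.swap)
      (simp add: matrix_matrix_mult_def transpose_def sum_distrib_left sum_distrib_right mult_ac)
  have split: "(\<Sum>i'\<in>UNIV. \<Sum>j'\<in>UNIV. \<Sum>s'\<in>UNIV. \<Sum>k'\<in>UNIV. f i' k' * g j' s')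
      = (\<Sum>i'\<in>UNIV. \<Sum>k'\<in>UNIV. f i' k') * (\<Sum>j'\<in>UNIV. \<Sum>s'\<in>UNIV. g j' s')"
    for f g :: "'n \<Rightarrow> 'n \<Rightarrow> real"
    by (simp only: sum_distrib_left[symmetric] sum_distrib_right[symmetric])
  have "change_form2 P (skew_product M N) $ i $ j $ s $ k
    = (\<Sum>i'\<in>UNIV. \<Sum>j'\<in>UNIV. \<Sum>s'\<in>UNIV. \<Sum>k'\<in>UNIV.
        (P $ i' $ i * ?Q $ k $ k' * M $ i' $ k') * (P $ j' $ j * P $ s' $ s * N $ j' $ s'))
    - (\<Sum>i'\<in>UNIV. \<Sum>j'\<in>UNIV. \<Sum>s'\<in>UNIV. \<Sum>k'\<in>UNIV.
        (P $ j' $ j * ?Q $ k $ k' * M $ j' $ k') * (P $ i' $ i * P $ s' $ s * N $ i' $ s'))"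
    for i j s k
    by (simp add: change_form2_def skew_product_def sum_subtractf right_diff_distrib mult_ac)
  also have "\<dots> i j s k
    = skew_product (transpose P ** M ** transpose ?Q) (transpose P ** N ** P) $ i $ j $ s $ k"
    for i j s k
    by (subst (5) sum.swap) (simp only: split M N skew_product_def vec_lambda_beta)
  finally show ?thesis by (simp add: vec_eq_iff)
qed

lemma matrix_inv_unique:
  fixes A B :: "real ^ 'n ^ 'n::finite"
  assumes "A ** B = mat 1"
  shows "matrix_inv A = B"
proof -
  have "invertible A" using assms matrix_left_right_inverse unfolding invertible_def by blast
  then have "matrix_inv A ** (A ** B) = B"
    by (simp add: matrix_mul_assoc matrix_inv_works)
  then show ?thesis by (simp add: assms)
qed

text \<open>
  The Jacobian is invertible as soon as it carries one nondegenerate form to another. The identity,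
  the mixed tensor \<open>b w\<^sup>-\<^sup>1\<close>, b and w all transform as tensors of their type.
\<close>

lemma schouten_cocycle_natural:
  assumes "nondegenerate_form w" "nondegenerate_form (change_cov2 P w)" "b \<in> sym2"
  shows "change_form2 P (schouten_cocycle w b)
    = schouten_cocycle (change_cov2 P w) (change_cov2 P b)"
proof -
  interpret w: nondegenerate_form w by (rule assms)
  interpret w': nondegenerate_form "change_cov2 P w" by (rule assms)
  let ?Q = "matrix_inv P"
  have "det P \<noteq> 0"
    using w'.invertible_form by (auto simp: change_cov2_def invertible_det_nz det_mul)
  then have PQ: "P ** ?Q = mat 1" and QP: "?Q ** P = mat 1"
    by (simp_all add: matrix_inv_works invertible_det_nz)
  have QP': "transpose P ** transpose ?Q = mat 1"
    using arg_cong[OF QP, of transpose] by (simp add: matrix_transpose_mul)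
  have "change_cov2 P w ** (?Q ** w.v ** transpose ?Q)
    = transpose P ** (w ** (P ** ?Q) ** w.v) ** transpose ?Q"
    by (simp add: change_cov2_def matrix_mul_assoc)
  also have "\<dots> = mat 1" by (simp add: PQ w.w_v QP')
  finally have inv: "w'.v = ?Q ** w.v ** transpose ?Q" by (rule matrix_inv_unique)
  have "change_cov2 P b ** w'.v = transpose P ** (b ** (P ** ?Q) ** w.v) ** transpose ?Q"
    unfolding inv by (simp add: change_cov2_def matrix_mul_assoc)
  then have bv: "change_cov2 P b ** w'.v = transpose P ** (b ** w.v) ** transpose ?Q"
    by (simp add: PQ)
  have "transpose b = b" using assms(3) by (simp add: sym2_def transpose_def vec_eq_iff)
  then have "transpose (change_cov2 P b) = change_cov2 P b"
    by (simp add: change_cov2_def matrix_transpose_mul matrix_mul_assoc)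
  then have sym: "change_cov2 P b \<in> sym2" unfolding sym2_def transpose_def vec_eq_iff by simp
  show ?thesis
    unfolding w.schouten_cocycle_eq_skew_product[OF assms(3)]
      w'.schouten_cocycle_eq_skew_product[OF sym] bv
    by (simp add: linear_scale[OF linear_change_form2] linear_add[OF linear_change_form2]
        change_form2_skew_product QP' change_cov2_def)
qed

lemma smooth_on_schouten_cocycle:
  fixes W :: "'a::euclidean_space \<Rightarrow> real ^ 'n ^ 'n::finite"
  assumes "smooth_on S W" "open S" "\<And>y. y \<in> S \<Longrightarrow> invertible (W y)"
  shows "smooth_on S (\<lambda>y. schouten_cocycle (W y) b)"
proof -
  have W: "smooth_on S (\<lambda>y. W y $ i $ j)" for i j
    by (intro smooth_on_vec_nth assms(1,2))
  have element: "smooth_on S (\<lambda>y. conf_element (W y) u $ i $ j $ k)" for u i j k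
    unfolding conf_element_def vec_lambda_beta
    by (rule smooth_on_diff[OF smooth_on_const smooth_on_mult assms(2)],
        rule W, rule smooth_on_sum[OF smooth_on_mult assms(2)],
        rule smooth_on_matrix_inv[OF W assms(2,3)], assumption,
        rule smooth_on_const, rule assms(2), rule assms(2))
  have "schouten_cocycle (W y) b = (\<chi> i j s k.
      conf_element (W y) ((1 / real CARD('n)) *\<^sub>R b $ j) $ i $ s $ k
      - conf_element (W y) ((1 / real CARD('n)) *\<^sub>R b $ i) $ j $ s $ k)" for y
    by (simp add: schouten_cocycle_def spencer1_def conformal_lift_def vec_eq_iff)
  moreover have "smooth_on S (\<lambda>y. \<chi> i j s k.
      conf_element (W y) ((1 / real CARD('n)) *\<^sub>R b $ j) $ i $ s $ k
      - conf_element (W y) ((1 / real CARD('n)) *\<^sub>R b $ i) $ j $ s $ k)"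
    by (rule smooth_on_vec_lambda[OF smooth_on_vec_lambda[OF smooth_on_vec_lambda[OF
          smooth_on_vec_lambda[OF smooth_on_diff]]]]) (rule element assms(2))+
  ultimately show ?thesis by simp
qed

lemma nondegenerate_metricD:
  assumes "nondegenerate_metric \<A> \<omega>" "c \<in> \<A>"
  shows "x \<in> fst c \<Longrightarrow> nondegenerate_form (\<omega> c x)"
    and "smooth_on (snd c ` fst c) (\<lambda>y. \<omega> c (inv_into (fst c) (snd c) y))"
    and "c' \<in> \<A> \<Longrightarrow> x \<in> fst c \<inter> fst c' \<Longrightarrow> \<omega> c x = change_cov2 (jacobian c c' x) (\<omega> c' x)"
proof -
  note D = assms(1)[unfolded nondegenerate_metric_def]
  show "nondegenerate_form (\<omega> c x)" if "x \<in> fst c"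
    using bspec[OF bspec[OF conjunct1[OF D] assms(2)] that] by (simp add: nondegenerate_form_def)
  show "smooth_on (snd c ` fst c) (\<lambda>y. \<omega> c (inv_into (fst c) (snd c) y))"
    by (rule bspec[OF conjunct1[OF conjunct2[OF D]] assms(2)])
  show "\<omega> c x = change_cov2 (jacobian c c' x) (\<omega> c' x)" if "c' \<in> \<A>" "x \<in> fst c \<inter> fst c'"
    by (rule bspec[OF bspec[OF bspec[OF conjunct2[OF conjunct2[OF D]] assms(2)] that(1)] that(2)])
qed

text \<open>
  In the smoothness condition the Schouten cocycle itself serves as the smooth section of cocycles

  representing the class.
\<close>

lemma bundle_morphism_schouten:
  assumes "smooth_manifold X \<A>" "nondegenerate_metric \<A> \<omega>"
  shows "bundle_morphism \<A> \<omega>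
    (\<lambda>c x b. cohomology_class (killing_symbol (\<omega> c x)) (schouten_cocycle (\<omega> c x) b))"
proof -
  note form = nondegenerate_metricD(1)[OF assms(2)]
  have covariant: "cohomology_class (killing_symbol (\<omega> c x))
      (schouten_cocycle (\<omega> c x) (change_cov2 (jacobian c c' x) a))
    = change_form2 (jacobian c c' x) `
      cohomology_class (killing_symbol (\<omega> c' x)) (schouten_cocycle (\<omega> c' x) a)"
    if "c \<in> \<A>" "c' \<in> \<A>" "x \<in> fst c \<inter> fst c'" "a \<in> sym2" for c c' x a
  proof -
    have x: "x \<in> fst c" "x \<in> fst c'" using that(3) by simp_all
    note \<omega> = nondegenerate_metricD(3)[OF assms(2) that(1-3)]
    have "change_form2 (jacobian c c' x) (schouten_cocycle (\<omega> c' x) a)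
        = schouten_cocycle (\<omega> c x) (change_cov2 (jacobian c c' x) a)"
      using schouten_cocycle_natural[OF form[OF that(2) x(2)] _ that(4), of "jacobian c c' x"]
        form[OF that(1) x(1)] by (simp only: flip: \<omega>)
    then show ?thesis
      by (simp only: nondegenerate_form.cohomology_class_killing[OF form[OF that(1) x(1)]]
          nondegenerate_form.cohomology_class_killing[OF form[OF that(2) x(2)]]
          image_insert image_empty)
  qed
  have smooth: "\<exists>s. smooth_on (snd c ` fst c) s \<and>
      (\<forall>x\<in>fst c. s (snd c x) \<in> cocycles2 (killing_symbol (\<omega> c x)) \<and>
        cohomology_class (killing_symbol (\<omega> c x)) (schouten_cocycle (\<omega> c x) a)
          = cohomology_class (killing_symbol (\<omega> c x)) (s (snd c x)))"
    if "c \<in> \<A>" "a \<in> sym2" for c a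
  proof -
    let ?S = "snd c ` fst c" and ?W = "\<lambda>y. \<omega> c (inv_into (fst c) (snd c) y)"
    have chart: "openin X (fst c)" "open ?S"
      "homeomorphic_map (subtopology X (fst c)) (top_of_set ?S) (snd c)"
      using assms(1) that(1) unfolding smooth_manifold_def by blast+
    have "topspace (subtopology X (fst c)) = fst c"
      using openin_subset[OF chart(1)] by auto
    then have "inj_on (snd c) (fst c)"
      using chart(3) by (simp add: homeomorphic_map_def)
    then have W: "?W (snd c x) = \<omega> c x" if "x \<in> fst c" for x
      using that by simp
    have "smooth_on ?S (\<lambda>y. schouten_cocycle (?W y) a)"
    proof (rule smooth_on_schouten_cocycle[OF _ chart(2)])
      show "smooth_on ?S ?W" by (rule nondegenerate_metricD(2)[OF assms(2) that(1)])
      show "invertible (?W y)" if "y \<in> ?S" for y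
        using nondegenerate_form.invertible_form[OF form[OF \<open>c \<in> \<A>\<close> inv_into_into[OF that]]] .
    qed
    moreover have "schouten_cocycle (\<omega> c x) a \<in> cocycles2 (killing_symbol (\<omega> c x))"
      if "x \<in> fst c" for x
      using nondegenerate_form.schouten_cocycle_killing[OF form[OF \<open>c \<in> \<A>\<close> that]] \<open>a \<in> sym2\<close>
      by simp
    ultimately show ?thesis using W by (intro exI[of _ "\<lambda>y. schouten_cocycle (?W y) a"]) simp
  qed
  show ?thesis
    unfolding bundle_morphism_def
  proof (intro conjI ballI, goal_cases)
    case (1 c x)
    then show ?case by (rule nondegenerate_form.lin_map_schouten_class[OF form])
  next
    case (2 c c' x a)
    then show ?case by (rule covariant)
  next
    case (3 c a)
    then show ?case by (rule smooth)
  qed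
qed

theorem theorem5p1:
  fixes X :: "'x topology"
    and \<A> :: "('x, 'n::finite) chart set"
    and \<omega> :: "('x, 'n) chart \<Rightarrow> 'x \<Rightarrow> real ^ 'n ^ 'n"
  assumes "smooth_manifold X \<A>"
    and "nondegenerate_metric \<A> \<omega>"
    and "CARD('n) \<ge> 3"
  shows "\<exists>\<sigma>. bundle_morphism \<A> \<omega> \<sigma> \<and>
    (\<forall>c\<in>\<A>. \<forall>x\<in>fst c.
      let w = \<omega> c x;
          g1 = killing_symbol w; g2 = prolong2 g1;
          h1 = conf_killing_symbol w; h2 = prolong2 h1; h3 = prolong3 h1
      in
        \<comment> \<open>the facts taken into account\<close>
        g1 \<subseteq> h1 \<and> g2 = {0} \<and> h3 = {0} \<and>
        h2 = range (conf_element w) \<and>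
        (\<forall>a. trace2 (conf_element w a) = real CARD('n) *\<^sub>R a) \<and>
        lin_iso (sub_space h2) (sub_space UNIV) trace2 \<and>
        \<comment> \<open>rows\<close>
        lin_iso (sub_space (cocycles2 g1)) (cohomology2 g1) (cohomology_class g1) \<and>
        short_exact (sub_space (cotensor h2)) spencer1
          (sub_space (cocycles2 h1)) (cohomology_class h1) (cohomology2 h1) \<and>
        short_exact (sub_space (sym2 :: (real ^ 'n ^ 'n) set)) (\<lambda>a. a)
          (sub_space (cotensor UNIV)) spencer1 (sub_space (wedge2 (UNIV :: real set))) \<and>
        \<comment> \<open>columns\<close>
        lin_iso (sub_space (cotensor h2)) (sub_space (cotensor UNIV)) cotensor_trace2 \<and>
        short_exact (sub_space (cocycles2 g1)) (\<lambda>z. z)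
          (sub_space (cocycles2 h1)) form_trace (sub_space (wedge2 UNIV)) \<and>
        short_exact (sub_space sym2) (\<sigma> c x)
          (cohomology2 g1) (cohomology_incl h1) (cohomology2 h1) \<and>
        \<comment> \<open>commutative squares\<close>
        (\<forall>z\<in>cocycles2 g1. cohomology_incl h1 (cohomology_class g1 z) = cohomology_class h1 z) \<and>
        (\<forall>\<zeta>\<in>cotensor h2. form_trace (spencer1 \<zeta>) = spencer1 (cotensor_trace2 \<zeta>)))"
proof (rule exI, rule conjI, rule bundle_morphism_schouten[OF assms(1,2)], intro ballI, goal_cases)
  case (1 c x)
  then interpret nondegenerate_form "\<omega> c x"
    using nondegenerate_metricD(1)[OF assms(2)] by blast
  have square: "form_trace (spencer1 \<zeta>) = spencer1 (cotensor_trace2 \<zeta>)"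
    if "\<zeta> \<in> cotensor (prolong2 (conf_killing_symbol (\<omega> c x)))" for \<zeta>
    using that by (intro form_trace_spencer1) (simp add: cotensor_def prolong2_def)
  show ?case
    unfolding Let_def
    by (intro conjI allI ballI killing_subset_conf prolong2_killing
        prolong3_conf_killing[OF assms(3)] prolong2_conf_killing trace2_conf_element
        lin_iso_trace2 lin_iso_class_killing
        short_exact_spencer_cohomology[OF subspace_conf_killing prolong3_conf_killing[OF assms(3)]]
        short_exact_skew_symmetrization lin_iso_cotensor_trace2 exact_middle_column
        exact_right_column[OF assms(3)] cohomology_incl_class square)
qed

end
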